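(* There exists a non-empty Zariski open subset $\Delta\subset\mathbb C^2$ such that for every $(d_0,k_0)\in\Delta$ the following hold. There is a set $\Gamma=\{(p_i,q_i,u_i)\}_{i=1,\dots,\delta_1}$ of exactly $\delta_1$ solutions of $\mathfrak S_2(d_0,k_0)$ such that the $q_i$ are pairwise distinct with $\mathcal L(k_0)\cap\mathcal O_{d_0}(\mathcal C)=\{q_1,\dots,q_{\delta_1}\}$ and the $p_i$ are pairwise distinct regular non-ramification points of $\mathcal C$; no point of $\mathcal C$ on the line $y_2=k_0$ is a ramification point; and moreover: (a) if $(p,q,u_0)\in\Gamma$ then $p\in\mathcal C\cap\mathcal S(d_0,k_0)$; (b) if $p\in\mathcal C\cap\mathcal S(d_0,k_0)$ and $p$ is not a ramification point of $\mathcal C$, then there exist $q\in\mathbb C^2$ and $u_0\in\mathbb C$ with $(p,q,u_0)\in\Gamma$.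
   Context: Standing assumptions and notation. $f(y_1,y_2)\in\mathbb C[y_1,y_2]$ is an irreducible polynomial of degree $n$ defining an affine plane curve $\mathcal C\subset\mathbb C^2$; $\mathcal C$ is not a line, and $f$ does not divide $f_1^2+f_2^2$, where $f_i=\partial f/\partial y_i$. Write $\bar y=(y_1,y_2)$, $\bar x=(x_1,x_2)$, and let $d,u$ be further variables. Put $b(\bar y,\bar x,d)=(x_1-y_1)^2+(x_2-y_2)^2-d^2$, $n(\bar y,\bar x)=-f_2(\bar y)(x_1-y_1)+f_1(\bar y)(x_2-y_2)$, $w(\bar y,u)=u(f_1^2(\bar y)+f_2^2(\bar y))-1$. Let $\Omega(d)\subset\mathbb C^6$ be the common zero set of $f,b,n,w$ in the variables $(\bar y,\bar x,d,u)$, and for $d_0\in\mathbb C\setminus\{0\}$ let $I(d_0)=\langle f,b(\bar y,\bar x,d_0),n,w\rangle\subset\mathbb C[\bar y,\bar x,u]$ and $\Omega(d_0)\subset\mathbb C^5$ its zero set. The offset of $\mathcal C$ at distance $d_0$ is $\mathcal O_{d_0}(\mathcal C)$, the Zariski closure of the projection of $\Omega(d_0)$ to the $\bar x$-coordinates; the generic offset $\mathcal O_d(\mathcal C)\subset\mathbb C^3$ is the Zariski closure of the projection of $\Omega(d)$ to the $(\bar x,d)$-coordinates (it is a surface). The generic offset equation $g(x_1,x_2,d)\in\mathbb C[\bar x,d]$ is a square-free polynomial defining the surface $\mathcal O_d(\mathcal C)$, normalized to have no factor of positive degree lying in $\mathbb C[d]$ (it is determined up to a nonzero constant factor). Let $\delta_1=\deg_{x_1}g$.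 For $(d_0,k_0)\in\mathbb C^2$, $\mathcal L(k_0)$ is the line $x_2=k_0$, and $\mathfrak S_2(d_0,k_0)$ is the system $f(\bar y)=0$, $b(\bar y,\bar x,d_0)=0$, $n(\bar y,\bar x)=0$, $w(\bar y,u)=0$, $x_2-k_0=0$ in the unknowns $(\bar y,\bar x,u)\in\mathbb C^5$. A point $p\in\mathcal C$ is a ramification point if $f_2(p)=0$; it is regular if it is a nonsingular point of $\mathcal C$. The auxiliary polynomial is $s(\bar y,d,k)=(f_1^2+f_2^2)(y_2-k)^2-f_2^2d^2$, and $\mathcal S(d_0,k_0)\subset\mathbb C^2$ is the zero set of $s(\bar y,d_0,k_0)$. *)

theory Defs
  imports Complex_Main "HOL-Computational_Algebra.Computational_Algebra"
begin

text \<open>A bivariate polynomial is an element of (C[y1])[y2]: the outer variable is the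
second coordinate, the coefficients are polynomials in the first coordinate.\<close>

type_synonym bipoly = "complex poly poly"

definition eval2 :: "bipoly \<Rightarrow> complex \<Rightarrow> complex \<Rightarrow> complex" where
  "eval2 p a b = poly (map_poly (\<lambda>c. poly c a) p) b"

definition pd1 :: "bipoly \<Rightarrow> bipoly" where "pd1 p = map_poly pderiv p"
definition pd2 :: "bipoly \<Rightarrow> bipoly" where "pd2 p = pderiv p"

definition zero_set2 :: "bipoly set \<Rightarrow> (complex \<times> complex) set" where
  "zero_set2 P = {(a, b). \<forall>p\<in>P. eval2 p a b = 0}"

definition zariski_closed2 :: "(complex \<times> complex) set \<Rightarrow> bool" where
  "zariski_closed2 A \<longleftrightarrow> (\<exists>P. A = zero_set2 P)"

definition zariski_open2 :: "(complex \<times> complex) set \<Rightarrow> bool" where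
  "zariski_open2 U \<longleftrightarrow> zariski_closed2 (- U)"

definition zariski_closure2 :: "(complex \<times> complex) set \<Rightarrow> (complex \<times> complex) set" where
  "zariski_closure2 S = \<Inter>{Z. zariski_closed2 Z \<and> S \<subseteq> Z}"

text \<open>Outermost variable x1, middle variable x2, innermost variable d. Hence the degree
in x1 is just \<open>degree\<close>.\<close>

type_synonym tripoly = "complex poly poly poly"

definition eval3 :: "tripoly \<Rightarrow> complex \<Rightarrow> complex \<Rightarrow> complex \<Rightarrow> complex" where
  "eval3 g a b c = poly (map_poly (\<lambda>q. poly (map_poly (\<lambda>r. poly r c) q) b) g) a"

definition zero_set3 :: "tripoly set \<Rightarrow> (complex \<times> complex \<times> complex) set" where
  "zero_set3 P = {(a, b, c). \<forall>p\<in>P. eval3 p a b c = 0}"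

definition zariski_closed3 :: "(complex \<times> complex \<times> complex) set \<Rightarrow> bool" where
  "zariski_closed3 A \<longleftrightarrow> (\<exists>P. A = zero_set3 P)"

definition zariski_closure3 ::
  "(complex \<times> complex \<times> complex) set \<Rightarrow> (complex \<times> complex \<times> complex) set" where
  "zariski_closure3 S = \<Inter>{Z. zariski_closed3 Z \<and> S \<subseteq> Z}"

definition bfun :: "complex \<times> complex \<Rightarrow> complex \<times> complex \<Rightarrow> complex \<Rightarrow> complex" where
  "bfun y x d = (fst x - fst y)\<^sup>2 + (snd x - snd y)\<^sup>2 - d\<^sup>2"

definition nfun :: "bipoly \<Rightarrow> complex \<times> complex \<Rightarrow> complex \<times> complex \<Rightarrow> complex" where
  "nfun f y x = - eval2 (pd2 f) (fst y) (snd y) * (fst x - fst y)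
              + eval2 (pd1 f) (fst y) (snd y) * (snd x - snd y)"

definition wfun :: "bipoly \<Rightarrow> complex \<times> complex \<Rightarrow> complex \<Rightarrow> complex" where
  "wfun f y u = u * ((eval2 (pd1 f) (fst y) (snd y))\<^sup>2 + (eval2 (pd2 f) (fst y) (snd y))\<^sup>2) - 1"

definition offset_sys ::
  "bipoly \<Rightarrow> complex \<Rightarrow> complex \<times> complex \<Rightarrow> complex \<times> complex \<Rightarrow> complex \<Rightarrow> bool" where
  "offset_sys f d y x u \<longleftrightarrow> eval2 f (fst y) (snd y) = 0 \<and> bfun y x d = 0 \<and>
      nfun f y x = 0 \<and> wfun f y u = 0"

definition offset :: "bipoly \<Rightarrow> complex \<Rightarrow> (complex \<times> complex) set" where
  "offset f d0 = zariski_closure2 {x. \<exists>y u. offset_sys f d0 y x u}"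

definition generic_offset :: "bipoly \<Rightarrow> (complex \<times> complex \<times> complex) set" where
  "generic_offset f =
     zariski_closure3 {(fst x, snd x, d) | x d. \<exists>y u. offset_sys f d y x u}"

definition generic_offset_equation :: "bipoly \<Rightarrow> tripoly \<Rightarrow> bool" where
  "generic_offset_equation f g \<longleftrightarrow>
     squarefree g \<and> zero_set3 {g} = generic_offset f \<and>
     (\<forall>c :: complex poly. [:[:c:]:] dvd g \<longrightarrow> degree c = 0)"

definition sys2 ::
  "bipoly \<Rightarrow> complex \<Rightarrow> complex \<Rightarrow> complex \<times> complex \<Rightarrow> complex \<times> complex \<Rightarrow> complex \<Rightarrow> bool" where
  "sys2 f d0 k0 y x u \<longleftrightarrow> offset_sys f d0 y x u \<and> snd x - k0 = 0"

definition on_curve :: "bipoly \<Rightarrow> complex \<times> complex \<Rightarrow> bool" where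
  "on_curve f p \<longleftrightarrow> eval2 f (fst p) (snd p) = 0"

definition ramification_point :: "bipoly \<Rightarrow> complex \<times> complex \<Rightarrow> bool" where
  "ramification_point f p \<longleftrightarrow> on_curve f p \<and> eval2 (pd2 f) (fst p) (snd p) = 0"

definition regular_point :: "bipoly \<Rightarrow> complex \<times> complex \<Rightarrow> bool" where
  "regular_point f p \<longleftrightarrow> on_curve f p \<and>
     (eval2 (pd1 f) (fst p) (snd p) \<noteq> 0 \<or> eval2 (pd2 f) (fst p) (snd p) \<noteq> 0)"

definition sfun :: "bipoly \<Rightarrow> complex \<times> complex \<Rightarrow> complex \<Rightarrow> complex \<Rightarrow> complex" where
  "sfun f y d k =
     ((eval2 (pd1 f) (fst y) (snd y))\<^sup>2 + (eval2 (pd2 f) (fst y) (snd y))\<^sup>2) * (snd y - k)\<^sup>2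
     - (eval2 (pd2 f) (fst y) (snd y))\<^sup>2 * d\<^sup>2"

definition S_set :: "bipoly \<Rightarrow> complex \<Rightarrow> complex \<Rightarrow> (complex \<times> complex) set" where
  "S_set f d0 k0 = {y. sfun f y d0 k0 = 0}"

definition curve :: "bipoly \<Rightarrow> (complex \<times> complex) set" where
  "curve f = {p. on_curve f p}"

definition standing_assumptions :: "bipoly \<Rightarrow> bool" where
  "standing_assumptions f \<longleftrightarrow>
     irreducible f \<and>
     \<not> (\<exists>a b c. (a, b) \<noteq> (0, 0) \<and> curve f = {(y1, y2). a * y1 + b * y2 + c = 0}) \<and>
     \<not> (f dvd (pd1 f)\<^sup>2 + (pd2 f)\<^sup>2)"

end

theory Submission
  imports Defs "HOL-Computational_Algebra.Field_as_Ring"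
begin

text \<open>Where it is smooth, the generic offset surface has the normal direction \<open>(x - y, -d)\<close> at the
  point \<open>(x, d)\<close> generated by the curve point \<open>y\<close>. In terms of the generic offset equation this is
  the identity \<open>d \<nabla>\<^sub>x g = - g\<^sub>d (x - y)\<close>, valid on all solutions of the offset system with
  \<open>d \<noteq> 0\<close>. Hence \<open>y = x + d \<nabla>\<^sub>x g / g\<^sub>d\<close> is a rational function of \<open>(x, d)\<close>: a generic offset
  point is generated by a single curve point. Conversely, the equations of the offset system, with
  this value substituted for \<open>y\<close>, hold on the image of the system, hence on its Zariski closure
  \<open>g = 0\<close>, so generic zeros of \<open>g\<close> do come from the curve. Since \<open>g\<close> is squarefree, a
  generic line \<open>x\<^sub>2 = k\<close> carries exactly \<open>deg g\<close> of them.\<close>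

section \<open>Evaluation of nested polynomials\<close>

lemma eval2_pCons [simp]: "eval2 (pCons c p) a b = poly c a + b * eval2 p a b"
  by (cases "c = 0 \<and> p = 0") (auto simp: eval2_def map_poly_pCons)

lemma eval2_0 [simp]: "eval2 0 a b = 0"
  by (simp add: eval2_def)

lemma eval2_conv_poly: "eval2 p a b = poly (poly p [:b:]) a"
  by (induction p) simp_all

lemma eval2_hom [simp]:
  "eval2 1 a b = 1" "eval2 (p + q) a b = eval2 p a b + eval2 q a b"
  "eval2 (p * q) a b = eval2 p a b * eval2 q a b" "eval2 (p ^ n) a b = eval2 p a b ^ n"
  "eval2 (p - q) a b = eval2 p a b - eval2 q a b" "eval2 (- p) a b = - eval2 p a b"
  "eval2 (of_nat n) a b = of_nat n" "eval2 (smult c p) a b = poly c a * eval2 p a b"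
  by (simp_all add: eval2_conv_poly)

lemma eval2_prod [simp]: "eval2 (\<Prod>x\<in>A. p x) a b = (\<Prod>x\<in>A. eval2 (p x) a b)"
  by (simp add: eval2_conv_poly poly_prod)

text \<open>The coefficients in x1 lie in C[d][x2], so \<open>eval2\<close> receives their arguments
  in the order d, x2. This is why the genericity conditions below read
  \<open>eval2 r d k\<close>.\<close>

lemma eval3_pCons [simp]: "eval3 (pCons e E) a b c = eval2 e c b + a * eval3 E a b c"
  by (cases "e = 0 \<and> E = 0") (auto simp: eval3_def map_poly_pCons eval2_def)

lemma eval3_0 [simp]: "eval3 0 a b c = 0"
  by (simp add: eval3_def)

lemma eval3_conv_eval2: "eval3 E a b c = eval2 (poly E [:[:a:]:]) c b"
  by (induction E) simp_all

lemma eval3_hom [simp]: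
  "eval3 1 a b c = 1" "eval3 (p + q) a b c = eval3 p a b c + eval3 q a b c"
  "eval3 (p * q) a b c = eval3 p a b c * eval3 q a b c"
  "eval3 (p ^ n) a b c = eval3 p a b c ^ n"
  "eval3 (p - q) a b c = eval3 p a b c - eval3 q a b c"
  "eval3 (- p) a b c = - eval3 p a b c" "eval3 (smult r p) a b c = eval2 r c b * eval3 p a b c"
  by (simp_all add: eval3_conv_eval2)

text \<open>The restriction of a trivariate polynomial to the line x2 = k in the plane at distance
  d, as a polynomial in x1 alone.\<close>

definition specialize :: "tripoly \<Rightarrow> complex \<Rightarrow> complex \<Rightarrow> complex poly" where
  "specialize g k d = map_poly (\<lambda>q. eval2 q d k) g"

lemma coeff_specialize [simp]: "coeff (specialize g k d) n = eval2 (coeff g n) d k"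
  by (simp add: specialize_def coeff_map_poly)

lemma poly_specialize [simp]: "poly (specialize g k d) a = eval3 g a k d"
  by (simp add: specialize_def eval3_def eval2_def)

lemma specialize_pderiv: "specialize (pderiv g) k d = pderiv (specialize g k d)"
proof (rule poly_eqI)
  fix n
  have "eval2 (of_nat (Suc n) * coeff g (Suc n)) d k = of_nat (Suc n) * eval2 (coeff g (Suc n)) d k"
    by (simp only: eval2_hom)
  then show "coeff (specialize (pderiv g) k d) n = coeff (pderiv (specialize g k d)) n"
    by (simp only: coeff_specialize coeff_pderiv)
qed

lemma degree_specialize:
  assumes "eval2 (lead_coeff g) d k \<noteq> 0"
  shows "degree (specialize g k d) = degree g"
  unfolding specialize_def by (rule map_poly_degree_eq) (use assms in simp)

lemma eval2_nonzero_witness: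
  assumes "p \<noteq> 0"
  shows "\<exists>a b. eval2 p a b \<noteq> 0"
proof (rule ccontr)
  assume "\<not> ?thesis"
  then have "poly (poly p [:b:]) a = 0" for a b
    by (simp add: eval2_conv_poly)
  then have root: "poly p [:b:] = 0" for b
    by (metis poly_all_0_iff_0)
  \<comment> \<open>The constants \<open>[:b:]\<close> would be infinitely many roots of
    \<open>p\<close> in the integral domain C[y1].\<close>
  have "infinite (range (\<lambda>b::complex. [:b:]))"
    using finite_imageD[of "\<lambda>b::complex. [:b:]" UNIV] infinite_UNIV_char_0
    by (auto simp: inj_def)
  then have "infinite {x. poly p x = 0}"
    using root by (elim contrapos_nn finite_subset[rotated]) auto
  with assms poly_roots_finite show False by blast
qed

section \<open>Polynomial functions and their closure properties\<close>

definition function_algebra :: "('x \<Rightarrow> complex) set \<Rightarrow> bool" where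
  "function_algebra S \<longleftrightarrow> (\<forall>c. (\<lambda>_. c) \<in> S) \<and>
     (\<forall>F\<in>S. \<forall>G\<in>S. (\<lambda>x. F x + G x) \<in> S \<and> (\<lambda>x. F x * G x) \<in> S)"

lemma function_algebraD:
  assumes "function_algebra S"
  shows "(\<lambda>_. c) \<in> S"
    and "F \<in> S \<Longrightarrow> G \<in> S \<Longrightarrow> (\<lambda>x. F x + G x) \<in> S"
    and "F \<in> S \<Longrightarrow> G \<in> S \<Longrightarrow> (\<lambda>x. F x * G x) \<in> S"
  using assms by (auto simp: function_algebra_def)

lemma poly_in_function_algebra:
  assumes S: "function_algebra S" and "U \<in> S"
  shows "(\<lambda>x. poly p (U x)) \<in> S"
  by (induction p) (auto intro!: function_algebraD[OF S] assms)

lemma eval2_in_function_algebra: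
  assumes S: "function_algebra S" and "U \<in> S" "V \<in> S"
  shows "(\<lambda>x. eval2 p (U x) (V x)) \<in> S"
  by (induction p) (auto intro!: function_algebraD[OF S] poly_in_function_algebra assms)

lemma eval3_in_function_algebra:
  assumes S: "function_algebra S" and "U \<in> S" "V \<in> S" "W \<in> S"
  shows "(\<lambda>x. eval3 p (U x) (V x) (W x)) \<in> S"
  by (induction p) (auto intro!: function_algebraD[OF S] eval2_in_function_algebra assms)

text \<open>Working with functions instead of polynomials lets compositions such as y -> E(y + s
  grad f(y), s^2 |grad f(y)|^2) be recognised as polynomial by closure rules, without computing
  coefficients.\<close>

definition polyfun2 :: "(complex \<times> complex \<Rightarrow> complex) set" where
  "polyfun2 = {F. \<exists>P. \<forall>a b. F (a, b) = eval2 P a b}"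

definition polyfun3 :: "(complex \<times> complex \<times> complex \<Rightarrow> complex) set" where
  "polyfun3 = {F. \<exists>P. \<forall>a b c. F (a, b, c) = eval3 P a b c}"

lemma function_algebra_polyfun2: "function_algebra polyfun2"
  unfolding function_algebra_def
proof (intro conjI allI ballI)
  show "(\<lambda>_. c) \<in> polyfun2" for c
    unfolding polyfun2_def by (auto intro: exI[of _ "[:[:c:]:]"])
next
  fix F G :: "complex \<times> complex \<Rightarrow> complex"
  assume "F \<in> polyfun2" "G \<in> polyfun2"
  then obtain P Q where "\<forall>a b. F (a, b) = eval2 P a b" "\<forall>a b. G (a, b) = eval2 Q a b"
    by (auto simp: polyfun2_def)
  then show "(\<lambda>x. F x + G x) \<in> polyfun2" "(\<lambda>x. F x * G x) \<in> polyfun2"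
    unfolding polyfun2_def by (auto intro: exI[of _ "P + Q"] exI[of _ "P * Q"])
qed

lemma function_algebra_polyfun3: "function_algebra polyfun3"
  unfolding function_algebra_def
proof (intro conjI allI ballI)
  show "(\<lambda>_. c) \<in> polyfun3" for c
    unfolding polyfun3_def by (auto intro: exI[of _ "[:[:[:c:]:]:]"])
next
  fix F G :: "complex \<times> complex \<times> complex \<Rightarrow> complex"
  assume "F \<in> polyfun3" "G \<in> polyfun3"
  then obtain P Q where "\<forall>a b c. F (a, b, c) = eval3 P a b c" "\<forall>a b c. G (a, b, c) = eval3 Q a b c"
    by (auto simp: polyfun3_def)
  then show "(\<lambda>x. F x + G x) \<in> polyfun3" "(\<lambda>x. F x * G x) \<in> polyfun3"
    unfolding polyfun3_def by (auto intro: exI[of _ "P + Q"] exI[of _ "P * Q"])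
qed

lemma coordinate_polyfun2: "fst \<in> polyfun2" "snd \<in> polyfun2"
  unfolding polyfun2_def by (auto intro: exI[of _ "[:[:0, 1:]:]"] exI[of _ "[:0, 1:]"])

lemma coordinate_polyfun3: "fst \<in> polyfun3" "(\<lambda>x. fst (snd x)) \<in> polyfun3"
    "(\<lambda>x. snd (snd x)) \<in> polyfun3"
  unfolding polyfun3_def
  by (auto intro: exI[of _ "[:0, 1:]"] exI[of _ "[:[:0, 1:]:]"] exI[of _ "[:[:[:0, 1:]:]:]"])

lemmas polyfun2_intros = function_algebraD[OF function_algebra_polyfun2]
  coordinate_polyfun2 eval2_in_function_algebra[OF function_algebra_polyfun2]
  eval3_in_function_algebra[OF function_algebra_polyfun2]

lemmas polyfun3_intros = function_algebraD[OF function_algebra_polyfun3]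
  coordinate_polyfun3 eval2_in_function_algebra[OF function_algebra_polyfun3]
  eval3_in_function_algebra[OF function_algebra_polyfun3]

lemma polyfun3_diff: "F \<in> polyfun3 \<Longrightarrow> G \<in> polyfun3 \<Longrightarrow> (\<lambda>x. F x - G x) \<in> polyfun3"
  using polyfun3_intros(2)[of F "\<lambda>x. (-1) * G x"] polyfun3_intros(3)[of "\<lambda>_. - 1" G]
    polyfun3_intros(1)[of "- 1"] by simp

lemma polyfun3_power: "F \<in> polyfun3 \<Longrightarrow> (\<lambda>x. F x ^ n) \<in> polyfun3"
  by (induction n) (auto intro: polyfun3_intros)

text \<open>Clearing denominators in p(U/W) by Horner's scheme: each coefficient costs one more
  power of \<open>W\<close>. Only the existence of an exponent is recorded, since powers of
  \<open>W\<close> are cancelled wherever \<open>W\<close> is nonzero.\<close>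

lemma poly_quotient_polyfun3:
  assumes "U \<in> polyfun3" "W \<in> polyfun3"
  shows "\<exists>N. \<exists>P\<in>polyfun3. \<forall>x. W x \<noteq> 0 \<longrightarrow> P x = W x ^ N * poly p (U x / W x)"
proof (induction p)
  case 0
  show ?case
    by (rule exI[of _ 0], rule bexI[of _ "\<lambda>_. 0"]) (auto intro: polyfun3_intros)
next
  case (pCons c p)
  then obtain N P where P: "P \<in> polyfun3"
    and eq: "\<And>x. W x \<noteq> 0 \<Longrightarrow> P x = W x ^ N * poly p (U x / W x)"
    by blast
  show ?case
  proof (rule exI[of _ "Suc N"], rule bexI[of _ "\<lambda>x. W x ^ Suc N * c + U x * P x"])
    show "(\<lambda>x. W x ^ Suc N * c + U x * P x) \<in> polyfun3"
      by (intro polyfun3_intros polyfun3_power assms P)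
    show "\<forall>x. W x \<noteq> 0 \<longrightarrow>
        W x ^ Suc N * c + U x * P x = W x ^ Suc N * poly (pCons c p) (U x / W x)"
    proof (intro allI impI)
      fix x assume W: "W x \<noteq> 0"
      define v where "v = U x / W x"
      have "U x = v * W x"
        using W by (simp add: v_def)
      then show "W x ^ Suc N * c + U x * P x = W x ^ Suc N * poly (pCons c p) (U x / W x)"
        unfolding eq[OF W] v_def [symmetric] by (simp add: algebra_simps)
    qed
  qed
qed

lemma eval2_quotient_polyfun3:
  assumes "U \<in> polyfun3" "V \<in> polyfun3" "W \<in> polyfun3"
  shows "\<exists>N. \<exists>P\<in>polyfun3. \<forall>x. W x \<noteq> 0 \<longrightarrow>
           P x = W x ^ N * eval2 p (U x / W x) (V x / W x)"
proof (induction p)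
  case 0
  show ?case
    by (rule exI[of _ 0], rule bexI[of _ "\<lambda>_. 0"]) (auto intro: polyfun3_intros)
next
  case (pCons c p)
  then obtain N P where P: "P \<in> polyfun3"
    and eqP: "\<And>x. W x \<noteq> 0 \<Longrightarrow> P x = W x ^ N * eval2 p (U x / W x) (V x / W x)"
    by blast
  obtain M Q where Q: "Q \<in> polyfun3"
    and eqQ: "\<And>x. W x \<noteq> 0 \<Longrightarrow> Q x = W x ^ M * poly c (U x / W x)"
    using poly_quotient_polyfun3[OF assms(1,3), of c] by blast
  show ?case
  \<comment> \<open>The coefficient \<open>c\<close> comes with its own exponent \<open>M\<close>;
    cross multiplication by powers of \<open>W\<close> brings both summands to a common
    exponent.\<close>
  proof (rule exI[of _ "Suc (N + M)"],
      rule bexI[of _ "\<lambda>x. W x ^ Suc N * Q x + W x ^ M * V x * P x"])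
    show "(\<lambda>x. W x ^ Suc N * Q x + W x ^ M * V x * P x) \<in> polyfun3"
      by (intro polyfun3_intros polyfun3_power assms P Q)
    show "\<forall>x. W x \<noteq> 0 \<longrightarrow> W x ^ Suc N * Q x + W x ^ M * V x * P x =
        W x ^ Suc (N + M) * eval2 (pCons c p) (U x / W x) (V x / W x)"
    proof (intro allI impI)
      fix x assume W: "W x \<noteq> 0"
      define v where "v = V x / W x"
      have "V x = v * W x"
        using W by (simp add: v_def)
      then show "W x ^ Suc N * Q x + W x ^ M * V x * P x =
          W x ^ Suc (N + M) * eval2 (pCons c p) (U x / W x) (V x / W x)"
        unfolding eqP[OF W] eqQ[OF W] v_def [symmetric] by (simp add: algebra_simps power_add)
    qed
  qed
qed

section \<open>Partial derivatives\<close>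

lemma eval2_chain:
  assumes "(a has_field_derivative a') (at s)" "(b has_field_derivative b') (at s)"
  shows "((\<lambda>s. eval2 p (a s) (b s)) has_field_derivative
      eval2 (pd1 p) (a s) (b s) * a' + eval2 (pd2 p) (a s) (b s) * b') (at s)"
proof (induction p)
  case 0
  show ?case by (simp add: pd1_def pd2_def)
next
  case (pCons c p)
  have "pd1 (pCons c p) = pCons (pderiv c) (pd1 p)" "pd2 (pCons c p) = p + pCons 0 (pd2 p)"
    by (cases "c = 0 \<and> p = 0"; auto simp: pd1_def pd2_def map_poly_pCons pderiv_pCons)+
  then show ?case
    by (auto intro!: derivative_eq_intros assms pCons.IH simp: algebra_simps)
qed

definition td1 :: "tripoly \<Rightarrow> tripoly" where "td1 = pderiv"
definition td2 :: "tripoly \<Rightarrow> tripoly" where "td2 = map_poly pderiv"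
definition td3 :: "tripoly \<Rightarrow> tripoly" where "td3 = map_poly (map_poly pderiv)"

lemma eval3_chain:
  assumes "(a has_field_derivative a') (at s)" "(b has_field_derivative b') (at s)"
    "(c has_field_derivative c') (at s)"
  shows "((\<lambda>s. eval3 p (a s) (b s) (c s)) has_field_derivative
      eval3 (td1 p) (a s) (b s) (c s) * a' + eval3 (td2 p) (a s) (b s) (c s) * b'
        + eval3 (td3 p) (a s) (b s) (c s) * c') (at s)"
proof (induction p)
  case 0
  show ?case by (simp add: td1_def td2_def td3_def)
next
  case (pCons e p)
  have "td1 (pCons e p) = p + pCons 0 (td1 p)" "td2 (pCons e p) = pCons (pd2 e) (td2 p)"
    "td3 (pCons e p) = pCons (pd1 e) (td3 p)"
    by (cases "e = 0 \<and> p = 0";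
        auto simp: td1_def td2_def td3_def pd1_def pd2_def map_poly_pCons pderiv_pCons)+
  then show ?case
    by (auto intro!: derivative_eq_intros assms pCons.IH eval2_chain simp: algebra_simps)
qed

section \<open>Common factors and generic coprimality\<close>

lemma prod_mset_degree_0:
  fixes A :: "'a::idom poly multiset"
  assumes "\<And>p. p \<in># A \<Longrightarrow> degree p = 0"
  shows "degree (prod_mset A) = 0"
  using assms
proof (induction A)
  case (add p A)
  then show ?case
    using degree_mult_le[of p "prod_mset A"] by simp
qed simp

text \<open>If every prime factor were constant in the main variable, so would be their product,
  which is associated to \<open>c\<close>.\<close>

lemma prime_factor_of_positive_degree:
  fixes c :: "'a::{factorial_ring_gcd,semiring_gcd_mult_normalize} poly"
  assumes "degree c > 0"
  shows "\<exists>p. prime_elem p \<and> p dvd c \<and> degree p > 0"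
proof (rule ccontr)
  assume "\<not> ?thesis"
  then have "degree p = 0" if "p \<in># prime_factorization c" for p
    using that by (metis in_prime_factors_iff prime_def gr0I)
  then have "degree (prod_mset (prime_factorization c)) = 0"
    by (rule prod_mset_degree_0)
  moreover have "normalize (prod_mset (prime_factorization c)) = normalize c"
    using assms by (intro prod_mset_prime_factorization_weak) auto
  then have "c dvd prod_mset (prime_factorization c)" "prod_mset (prime_factorization c) \<noteq> 0"
    using assms by (auto dest: associatedD2)
  then have "degree c \<le> degree (prod_mset (prime_factorization c))"
    by (rule dvd_imp_degree_le)
  ultimately show False
    using assms by simp
qed

text \<open>A prime \<open>p\<close> of positive degree with g = p m does not divide
  \<open>m\<close>, so it divides g' = p m' + m p' only if it divides p', which is nonzero in
  characteristic 0 and of smaller degree. Factors constant in the main variable may be shared, hence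
  the conclusion on the degree only.\<close>

lemma common_factor_pderiv_of_squarefree:
  fixes g :: "'a::{factorial_ring_gcd,semiring_gcd_mult_normalize,semiring_char_0} poly"
  assumes "squarefree g" "c dvd g" "c dvd pderiv g"
  shows "degree c = 0"
proof (rule ccontr)
  assume "degree c \<noteq> 0"
  then obtain p where p: "prime_elem p" "p dvd c" "degree p > 0"
    using prime_factor_of_positive_degree by blast
  then obtain m where m: "g = p * m"
    using assms(2) by (metis dvd_trans dvdE)
  have "p dvd p * pderiv m + m * pderiv p"
    using p(2) assms(3) unfolding m pderiv_mult by (rule dvd_trans)
  then have "p dvd m * pderiv p"
    by (simp add: dvd_add_right_iff)
  moreover have "\<not> p dvd m"
  proof
    assume "p dvd m"
    then have "p\<^sup>2 dvd g"
      by (auto simp: m power2_eq_square)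
    with assms(1) have "p dvd 1"
      by (rule squarefreeD)
    with p(1) show False
      by (auto simp: prime_elem_def)
  qed
  ultimately have "p dvd pderiv p"
    using p(1) by (simp add: prime_elem_dvd_mult_iff)
  moreover have "pderiv p \<noteq> 0"
    using p(3) by (simp add: pderiv_eq_0_iff)
  ultimately have "degree p \<le> degree (pderiv p)"
    by (rule dvd_imp_degree_le)
  with p(3) show False
    by (simp add: degree_pderiv)
qed

text \<open>Euclid's algorithm over the fraction field of the coefficients, with denominators
  cleared; \<open>r\<close> takes the place of a resultant. A nonzero element of least degree in the
  ideal (p, q) has a primitive part that divides both \<open>p\<close> and \<open>q\<close>.\<close>

lemma bezout_constant:
  fixes p q :: "'a::{factorial_ring_gcd,semiring_gcd_mult_normalize} poly"
  assumes "q \<noteq> 0" and common: "\<And>c. c dvd p \<Longrightarrow> c dvd q \<Longrightarrow> degree c = 0"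
  shows "\<exists>a b r. r \<noteq> 0 \<and> a * p + b * q = [:r:]"
proof -
  define P where "P m \<longleftrightarrow> m \<noteq> 0 \<and> (\<exists>a b. m = a * p + b * q)" for m
  have "q = 0 * p + 1 * q"
    by simp
  then have "P q"
    unfolding P_def using assms(1) by blast
  then obtain m where m: "P m" and min: "\<And>x. P x \<Longrightarrow> degree m \<le> degree x"
    using exists_least_iff[of "\<lambda>n. \<exists>x. P x \<and> degree x = n"] by (metis not_less)
  from m obtain a b where m0: "m \<noteq> 0" and ab: "m = a * p + b * q"
    by (auto simp: P_def)
  have dvd: "primitive_part m dvd z" if z: "z = a' * p + b' * q" for z a' b'
  proof -
    obtain e s where e: "e \<noteq> 0" "smult e z = m * s + pseudo_mod z m"
      using pseudo_mod(1)[OF m0] by blast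
    \<comment> \<open>The pseudo-remainder stays in the ideal and, unless zero, has degree below
      that of \<open>m\<close>; minimality makes it zero.\<close>
    have "pseudo_mod z m = ([:e:] * a' - s * a) * p + ([:e:] * b' - s * b) * q"
    proof -
      have "pseudo_mod z m = [:e:] * z - m * s"
        using e(2) by simp
      also have "\<dots> = ([:e:] * a' - s * a) * p + ([:e:] * b' - s * b) * q"
        by (simp only: z ab algebra_simps)
      finally show ?thesis .
    qed
    then have "pseudo_mod z m = 0"
      using pseudo_mod(2)[OF m0, of z] min[of "pseudo_mod z m"] unfolding P_def
      by (metis not_less)
    then have "m dvd smult e z"
      using e(2) by simp
    \<comment> \<open>So far \<open>m\<close> divides only a scalar multiple of \<open>z\<close>;
      passing to primitive parts removes the scalar.\<close>
    then have "primitive_part m dvd primitive_part (smult e z)"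
      using e(1) by (metis primitive_part_dvd_primitive_partI)
    moreover have "primitive_part (smult e z) dvd z"
    proof -
      have "primitive_part (smult e z) = [:unit_factor e:] * primitive_part z"
        by (simp add: primitive_part_smult)
      moreover have "is_unit [:unit_factor e:]"
        using e(1) by (simp add: is_unit_const_poly_iff)
      moreover have "primitive_part z dvd z"
        using dvd_smult[OF dvd_refl, of "primitive_part z" "content z"] by simp
      ultimately show ?thesis
        by (simp only: mult_unit_dvd_iff')
    qed
    ultimately show ?thesis by (rule dvd_trans)
  qed
  have "primitive_part m dvd p" "primitive_part m dvd q"
    using dvd[of p 1 0] dvd[of q 0 1] by simp_all
  then have "degree m = 0"
    using common by (metis degree_primitive_part)
  then obtain r where r: "m = [:r:]"
    by (rule degree_eq_zeroE)
  moreover have "r \<noteq> 0"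
    using m0 r by simp
  ultimately show ?thesis
    using ab by metis
qed

lemma irreducible_dvd_or_bezout:
  fixes f F :: "'a::{factorial_ring_gcd,semiring_gcd_mult_normalize} poly"
  assumes "irreducible f" "\<not> f dvd F"
  shows "\<exists>a b r. r \<noteq> 0 \<and> a * f + b * F = [:r:]"
proof (rule bezout_constant)
  show "F \<noteq> 0"
    using assms(2) by auto
next
  fix c assume c: "c dvd f" "c dvd F"
  have "\<not> f dvd c"
    using c(2) assms(2) dvd_trans by blast
  then have "is_unit c"
    using assms(1) c(1) irreducibleD' by blast
  then show "degree c = 0"
    by (simp add: is_unit_iff_degree is_unit_poly_iff) auto
qed

section \<open>Zeros on an irreducible plane curve\<close>

lemma curve_point_over:
  fixes f :: bipoly
  assumes "degree f > 0" "poly (lead_coeff f) a \<noteq> 0"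
  shows "\<exists>b. eval2 f a b = 0"
proof -
  have "degree (map_poly (\<lambda>c. poly c a) f) = degree f"
    by (rule map_poly_degree_eq) (use assms(2) in simp)
  then have "\<exists>b. poly (map_poly (\<lambda>c. poly c a) f) b = 0"
    using assms(1) by (intro alg_closed_imp_poly_has_root) simp
  then show ?thesis
    by (simp add: eval2_def)
qed

text \<open>If \<open>f\<close> did not divide \<open>F\<close>, a nonzero combination of the two
  would involve y1 only and vanish at the first coordinate of every curve point, although almost
  every vertical line meets the curve.\<close>

lemma irreducible_nullstellensatz:
  fixes f F :: bipoly
  assumes "irreducible f" "degree f > 0"
    and vanish: "\<And>a b. eval2 f a b = 0 \<Longrightarrow> eval2 F a b = 0"
  shows "f dvd F"
proof (rule ccontr)
  assume "\<not> f dvd F"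
  then obtain u v r where r: "r \<noteq> 0" "u * f + v * F = [:r:]"
    using irreducible_dvd_or_bezout assms(1) by blast
  have "r * lead_coeff f \<noteq> 0"
    using r(1) assms(2) by auto
  then obtain a where "poly (r * lead_coeff f) a \<noteq> 0"
    using poly_all_0_iff_0 by blast
  then have a: "poly r a \<noteq> 0" "poly (lead_coeff f) a \<noteq> 0"
    by auto
  obtain b where b: "eval2 f a b = 0"
    using curve_point_over assms(2) a(2) by blast
  have "eval2 (u * f + v * F) a b = 0"
    using b vanish by simp
  with r(2) a(1) show False
    by simp
qed

lemma finite_curve_fibre:
  fixes f :: bipoly
  assumes "irreducible f" "degree f > 0"
  shows "finite {b. eval2 f a b = 0}"
proof -
  \<comment> \<open>A vertical line inside the curve would make y1 - a a factor of \<open>f\<close>,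
    hence an associate of it, against the positive degree in y2.\<close>
  have "map_poly (\<lambda>c. poly c a) f \<noteq> 0"
  proof
    assume "map_poly (\<lambda>c. poly c a) f = 0"
    then have "poly (coeff f n) a = 0" for n
      by (metis coeff_0 coeff_map_poly poly_0)
    then have "[:[:-a, 1:]:] dvd f"
      by (simp add: const_poly_dvd_iff poly_eq_0_iff_dvd)
    moreover have "\<not> is_unit [:[:-a, 1:]:]"
      by (simp add: is_unit_const_poly_iff is_unit_pCons_iff)
    ultimately have "f dvd [:[:-a, 1:]:]"
      using assms(1) irreducibleD' by blast
    then have "degree f \<le> degree [:[:-a, 1:]:]"
      by (rule dvd_imp_degree_le) simp
    with assms(2) show False by simp
  qed
  then show ?thesis
    using poly_roots_finite by (simp add: eval2_def)
qed

text \<open>Eliminating y2 leaves finitely many first coordinates, and over each of them the curve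
  has finitely many points.\<close>

lemma finite_common_zeros:
  fixes f F :: bipoly
  assumes "irreducible f" "degree f > 0" "\<not> f dvd F"
  shows "finite {p. eval2 f (fst p) (snd p) = 0 \<and> eval2 F (fst p) (snd p) = 0}"
proof -
  obtain u v r where r: "r \<noteq> 0" "u * f + v * F = [:r:]"
    using irreducible_dvd_or_bezout assms by blast
  have "poly r a = 0" if "eval2 f a b = 0" "eval2 F a b = 0" for a b
  proof -
    have "poly r a = eval2 (u * f + v * F) a b"
      unfolding r(2) by simp
    with that show ?thesis by simp
  qed
  then have "{p. eval2 f (fst p) (snd p) = 0 \<and> eval2 F (fst p) (snd p) = 0}
      \<subseteq> (SIGMA a:{a. poly r a = 0}. {b. eval2 f a b = 0})"
    by auto
  moreover have "finite (SIGMA a:{a. poly r a = 0}. {b. eval2 f a b = 0})"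
    using poly_roots_finite[OF r(1)] finite_curve_fibre[OF assms(1,2)] by (rule finite_SigmaI)
  ultimately show ?thesis
    by (rule finite_subset)
qed

text \<open>The polynomial f2 is nonzero and of smaller y2-degree than \<open>f\<close>, so
  \<open>f\<close> does not divide it.\<close>

lemma finite_ramification_points:
  assumes "irreducible f" "degree f > 0"
  shows "finite {p. ramification_point f p}"
proof -
  have "pd2 f \<noteq> 0"
    using assms(2) by (simp add: pd2_def pderiv_eq_0_iff)
  then have "\<not> f dvd pd2 f"
    using assms(2) dvd_imp_degree_le[of f "pd2 f"] by (auto simp: pd2_def degree_pderiv)
  then show ?thesis
    using finite_common_zeros[OF assms] by (simp add: ramification_point_def on_curve_def)
qed

text \<open>An irreducible \<open>f\<close> free of y2 is linear in y1, so its curve is a vertical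
  line; the hypothesis that the curve is not a line enters here.\<close>

lemma standing_assumptions_degree_pos:
  assumes "standing_assumptions f"
  shows "degree f > 0"
proof (rule ccontr)
  have irr: "irreducible f"
    and line: "\<And>a b c. (a, b) \<noteq> (0, 0) \<Longrightarrow> curve f \<noteq> {(y1, y2). a * y1 + b * y2 + c = 0}"
    using assms by (auto simp: standing_assumptions_def)
  assume "\<not> degree f > 0"
  then obtain c where c: "f = [:c:]"
    by (auto elim: degree_eq_zeroE)
  have "c \<noteq> 0"
    using irr c by auto
  moreover have "\<not> is_unit c"
    using irr c irreducible_not_unit[of f] by (simp only: is_unit_const_poly_iff) simp
  ultimately have "degree c > 0"
    using is_unit_iff_degree by blast
  then obtain a where a: "poly c a = 0"
    using alg_closed_imp_poly_has_root by blast
  then obtain e where e: "c = [:-a, 1:] * e"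
    by (auto simp: poly_eq_0_iff_dvd)
  have "f = [:[:-a, 1:]:] * [:e:]"
    by (simp add: c e)
  then have "is_unit [:[:-a, 1:]:] \<or> is_unit [:e:]"
    using irr irreducibleD by blast
  then have "is_unit e"
    by (auto simp: is_unit_const_poly_iff is_unit_pCons_iff)
  then have "poly e x \<noteq> 0" for x
    by (auto simp: is_unit_poly_iff)
  then have "curve f = {(y1, y2). 1 * y1 + 0 * y2 + (-a) = 0}"
    unfolding curve_def on_curve_def c e by (auto simp: algebra_simps)
  then show False
    using line[of 1 0 "-a"] by simp
qed

section \<open>Elimination of x1 for generic (d, k)\<close>

lemma generic_coprime:
  fixes g H :: tripoly
  assumes "H \<noteq> 0" "\<And>c. c dvd g \<Longrightarrow> c dvd H \<Longrightarrow> degree c = 0"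
  shows "\<exists>r. r \<noteq> 0 \<and> (\<forall>a k d. eval2 r d k \<noteq> 0 \<longrightarrow> eval3 g a k d = 0 \<longrightarrow> eval3 H a k d \<noteq> 0)"
proof -
  obtain u v r where r: "r \<noteq> 0" "u * g + v * H = [:r:]"
    using bezout_constant assms by blast
  have "eval2 r d k = 0" if "eval3 g a k d = 0" "eval3 H a k d = 0" for a k d
  proof -
    have "eval2 r d k = eval3 (u * g + v * H) a k d"
      unfolding r(2) by simp
    with that show ?thesis by simp
  qed
  with r(1) show ?thesis by blast
qed

text \<open>Off the zeros of an eliminant of \<open>g\<close> and its x1-derivative, the restricted
  polynomial has only simple roots; off those of the leading coefficient it keeps its degree. Over C
  it then has exactly deg g roots.\<close>

lemma generic_separable:
  fixes g :: tripoly
  assumes "squarefree g"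
  shows "\<exists>r. r \<noteq> 0 \<and> (\<forall>k d. eval2 r d k \<noteq> 0 \<longrightarrow>
           finite {a. eval3 g a k d = 0} \<and> card {a. eval3 g a k d = 0} = degree g \<and>
           (\<forall>a. eval3 g a k d = 0 \<longrightarrow> eval3 (td1 g) a k d \<noteq> 0))"
proof -
  have g0: "g \<noteq> 0"
    using assms by auto
  have "\<exists>r. r \<noteq> 0 \<and> (\<forall>a k d. eval2 r d k \<noteq> 0 \<longrightarrow> eval3 g a k d = 0 \<longrightarrow> eval3 (td1 g) a k d \<noteq> 0)"
  proof (cases "pderiv g = 0")
    \<comment> \<open>Here \<open>g\<close> is free of x1; where \<open>e\<close> is nonzero there
      is no root, so the claim is vacuous.\<close>
    case True
    then have "degree g = 0"
      by (simp add: pderiv_eq_0_iff)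
    then obtain e where e: "g = [:e:]"
      by (rule degree_eq_zeroE)
    then show ?thesis
      using g0 by (intro exI[of _ e]) simp
  next
    case False
    then show ?thesis
      unfolding td1_def using common_factor_pderiv_of_squarefree[OF assms]
      by (intro generic_coprime) auto
  qed
  then obtain r where r: "r \<noteq> 0"
    and sep: "\<And>a k d. eval2 r d k \<noteq> 0 \<Longrightarrow> eval3 g a k d = 0 \<Longrightarrow> eval3 (td1 g) a k d \<noteq> 0"
    by blast
  have "finite {a. eval3 g a k d = 0} \<and> card {a. eval3 g a k d = 0} = degree g"
    if "eval2 (r * lead_coeff g) d k \<noteq> 0" for k d
  proof -
    let ?G = "specialize g k d"
    have deg: "degree ?G = degree g"
      using that by (intro degree_specialize) simp
    have G0: "?G \<noteq> 0"
      using that by (metis coeff_0 coeff_specialize eval2_hom(3) mult_zero_right)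
    have "rsquarefree ?G"
      unfolding rsquarefree_roots specialize_pderiv [symmetric]
      using sep that by (auto simp: td1_def)
    then have "smult (lead_coeff ?G) (\<Prod>z|poly ?G z = 0. [:-z, 1:]) = ?G"
      by (rule complex_poly_decompose_rsquarefree)
    then have "degree ?G = degree (\<Prod>z|poly ?G z = 0. [:-z, 1:])"
      using G0 by (metis degree_smult_eq leading_coeff_0_iff)
    also have "\<dots> = card {z. poly ?G z = 0}"
      by (subst degree_prod_eq_sum_degree) auto
    finally show ?thesis
      using poly_roots_finite[OF G0] deg by simp
  qed
  then show ?thesis
    using r g0 sep by (intro exI[of _ "r * lead_coeff g"]) auto
qed

section \<open>The normal of the generic offset\<close>

text \<open>The squared length of the gradient. On the curve it vanishes exactly where w = 0 has no
  solution u: at singular points and where the normal direction is isotropic.\<close>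

definition normsq :: "bipoly \<Rightarrow> bipoly" where
  "normsq f = (pd1 f)\<^sup>2 + (pd2 f)\<^sup>2"

lemma eval2_normsq: "eval2 (normsq f) a b = (eval2 (pd1 f) a b)\<^sup>2 + (eval2 (pd2 f) a b)\<^sup>2"
  by (simp add: normsq_def)

text \<open>The offset system involves d only through d^2. Splitting by parity reduces
  \<open>g\<close> to polynomials in d^2, which are polynomial in the parameter of a normal
  line.\<close>

lemma poly_even_odd:
  fixes p :: "complex poly"
  shows "\<exists>e r. \<forall>c. poly p c = poly e (c\<^sup>2) + c * poly r (c\<^sup>2)"
proof (induction p)
  case 0
  show ?case by (intro exI[of _ 0]) simp
next
  case (pCons a p)
  then obtain e o' where "\<And>c. poly p c = poly e (c\<^sup>2) + c * poly o' (c\<^sup>2)" by blast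
  then show ?case
    \<comment> \<open>Multiplication by the variable exchanges parities: the old even part becomes
      the new odd part.\<close>
    by (intro exI[of _ "pCons a o'"] exI[of _ e]) (simp add: algebra_simps power2_eq_square)
qed

lemma eval2_even_odd:
  "\<exists>e r. \<forall>c b. eval2 p c b = eval2 e (c\<^sup>2) b + c * eval2 r (c\<^sup>2) b"
proof (induction p)
  case 0
  show ?case by (intro exI[of _ 0]) simp
next
  case (pCons a p)
  then obtain e o' where "\<And>c b. eval2 p c b = eval2 e (c\<^sup>2) b + c * eval2 o' (c\<^sup>2) b" by blast
  moreover obtain ea oa where "\<And>c. poly a c = poly ea (c\<^sup>2) + c * poly oa (c\<^sup>2)"
    using poly_even_odd by blast
  ultimately show ?case
    by (intro exI[of _ "pCons ea e"] exI[of _ "pCons oa o'"]) (simp add: algebra_simps)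
qed

lemma eval3_even_odd:
  "\<exists>e r. \<forall>a b c. eval3 p a b c = eval3 e a b (c\<^sup>2) + c * eval3 r a b (c\<^sup>2)"
proof (induction p)
  case 0
  show ?case by (intro exI[of _ 0]) simp
next
  case (pCons q p)
  then obtain e o' where "\<And>a b c. eval3 p a b c = eval3 e a b (c\<^sup>2) + c * eval3 o' a b (c\<^sup>2)" by blast
  moreover obtain eq oq where "\<And>c b. eval2 q c b = eval2 eq (c\<^sup>2) b + c * eval2 oq (c\<^sup>2) b"
    using eval2_even_odd by blast
  ultimately show ?case
    by (intro exI[of _ "pCons eq e"] exI[of _ "pCons oq o'"]) (simp add: algebra_simps)
qed

lemma offset_sys_normal_point:
  assumes "eval2 f a b = 0" "eval2 (normsq f) a b \<noteq> 0" "d\<^sup>2 = t\<^sup>2 * eval2 (normsq f) a b"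
  shows "offset_sys f d (a, b) (a + t * eval2 (pd1 f) a b, b + t * eval2 (pd2 f) a b)
           (1 / eval2 (normsq f) a b)"
  using assms unfolding offset_sys_def bfun_def nfun_def wfun_def eval2_normsq
  by (simp add: algebra_simps power_mult_distrib)

text \<open>The equation n = 0 makes x - y parallel to the gradient, whose squared length is
  invertible by w = 0. So x - y = t grad f, and b = 0 becomes d^2 = t^2 |grad f|^2. With
  \<open>offset_sys_normal_point\<close> this describes all solutions by points on normal
  lines.\<close>

lemma offset_sysE:
  assumes "offset_sys f d y x u"
  obtains t where "eval2 f (fst y) (snd y) = 0" "eval2 (normsq f) (fst y) (snd y) \<noteq> 0"
    "fst x = fst y + t * eval2 (pd1 f) (fst y) (snd y)"
    "snd x = snd y + t * eval2 (pd2 f) (fst y) (snd y)"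
    "d\<^sup>2 = t\<^sup>2 * eval2 (normsq f) (fst y) (snd y)"
    "u = 1 / eval2 (normsq f) (fst y) (snd y)"
proof -
  define F1 F2 h where "F1 = eval2 (pd1 f) (fst y) (snd y)" and "F2 = eval2 (pd2 f) (fst y) (snd y)"
    and "h = eval2 (normsq f) (fst y) (snd y)"
  define v1 v2 where "v1 = fst x - fst y" and "v2 = snd x - snd y"
  have h: "h = F1\<^sup>2 + F2\<^sup>2"
    by (simp add: h_def F1_def F2_def eval2_normsq)
  have sys: "eval2 f (fst y) (snd y) = 0" "v1\<^sup>2 + v2\<^sup>2 = d\<^sup>2" "F2 * v1 = F1 * v2" "u * h = 1"
    using assms unfolding offset_sys_def bfun_def nfun_def wfun_def h
    by (simp_all add: F1_def F2_def v1_def v2_def)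
  have h0: "h \<noteq> 0"
    using sys(4) by auto
  \<comment> \<open>The coefficient of the orthogonal projection of x - y onto the gradient.\<close>
  define t where "t = (v1 * F1 + v2 * F2) / h"
  have t1: "v1 = t * F1"
  proof -
    have "v1 * h = (v1 * F1 + v2 * F2) * F1"
      using sys(3) unfolding h by algebra
    with h0 show ?thesis by (simp add: t_def field_simps)
  qed
  have t2: "v2 = t * F2"
  proof -
    have "v2 * h = (v1 * F1 + v2 * F2) * F2"
      using sys(3) unfolding h by algebra
    with h0 show ?thesis by (simp add: t_def field_simps)
  qed
  have "d\<^sup>2 = t\<^sup>2 * h"
    unfolding sys(2) [symmetric] t1 t2 h by algebra
  moreover have "u = 1 / h"
    using sys(4) h0 by (simp add: field_simps)
  moreover have "fst x = fst y + t * F1" "snd x = snd y + t * F2"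
    using t1 t2 by (simp_all add: v1_def v2_def algebra_simps)
  ultimately show ?thesis
    using sys(1) h0 that unfolding h_def F1_def F2_def by blast
qed

text \<open>Put F = (F1, F2), T = (-F2, F1), w = (w1, w2). Eliminating \<open>e3\<close> by means of
  h w = (F.w) F + (T.w) T leaves the tangential component of (e1, e2) times h + t (T.w). The latter
  is the Jacobian of the normal map, which vanishes at focal points.\<close>

lemma gradient_identities:
  fixes e1 e2 e3 F1 F2 w1 w2 t h :: complex
  assumes h: "h = F1\<^sup>2 + F2\<^sup>2"
    and along_normal: "e1 * F1 + e2 * F2 + e3 * (2 * t * h) = 0"
    and along_curve: "e1 * (- F2 + t * w1) + e2 * (F1 + t * w2)
      + e3 * (t\<^sup>2 * (2 * F1 * w1 + 2 * F2 * w2)) = 0"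
  shows "(e2 * F1 - e1 * F2) * (h + t * (F1 * w2 - F2 * w1)) = 0"
  using assms by algebra

text \<open>For fixed \<open>t\<close>, the polynomial \<open>E(y + t \<nabla>f(y), t\<^sup>2 \<bar>\<nabla>f(y)\<bar>\<^sup>2)\<close> in \<open>y\<close> is divisible by \<open>f\<close>, so its derivative
  along the tangent \<open>(-f\<^sub>2, f\<^sub>1)\<close> vanishes on the curve; differentiating in \<open>t\<close> gives a second
  relation. Working with \<open>d\<^sup>2\<close> instead of \<open>d\<close> avoids the square root \<open>\<bar>\<nabla>f\<bar>\<close>.\<close>

lemma offset_gradient_even:
  assumes irr: "irreducible f" and deg: "degree f > 0" and nd: "\<not> f dvd normsq f"
    and vanish: "\<forall>x d y u. offset_sys f d y x u \<longrightarrow> d \<noteq> 0 \<longrightarrow> eval3 E (fst x) (snd x) (d\<^sup>2) = 0"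
    and y: "eval2 f y1 y2 = 0" and hy: "eval2 (normsq f) y1 y2 \<noteq> 0"
    and t: "t \<noteq> 0"
    and F: "F1 = eval2 (pd1 f) y1 y2" "F2 = eval2 (pd2 f) y1 y2" "h = eval2 (normsq f) y1 y2"
  shows "eval3 (td1 E) (y1 + t * F1) (y2 + t * F2) (t\<^sup>2 * h)
           = - 2 * t * F1 * eval3 (td3 E) (y1 + t * F1) (y2 + t * F2) (t\<^sup>2 * h)"
    and "eval3 (td2 E) (y1 + t * F1) (y2 + t * F2) (t\<^sup>2 * h)
           = - 2 * t * F2 * eval3 (td3 E) (y1 + t * F1) (y2 + t * F2) (t\<^sup>2 * h)"
proof -
  have h: "h = F1\<^sup>2 + F2\<^sup>2"
    by (simp add: F eval2_normsq)
  have zero: "eval3 E (a + s * eval2 (pd1 f) a b) (b + s * eval2 (pd2 f) a b)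
      (s\<^sup>2 * eval2 (normsq f) a b) = 0"
    if "eval2 f a b = 0" "eval2 (normsq f) a b \<noteq> 0" "s \<noteq> 0" for a b s
  proof -
    \<comment> \<open>Any square root of s^2 h serves as a distance for which the point solves the
      offset system.\<close>
    define d where "d = s * csqrt (eval2 (normsq f) a b)"
    have d: "d\<^sup>2 = s\<^sup>2 * eval2 (normsq f) a b"
      by (simp add: d_def power_mult_distrib)
    moreover have "d \<noteq> 0"
      using that by (simp add: d_def)
    ultimately show ?thesis
      using vanish offset_sys_normal_point[OF that(1,2) d] by fastforce
  qed
  have normal: "eval3 (td1 E) (y1 + s * F1) (y2 + s * F2) (s\<^sup>2 * h) * F1
      + eval3 (td2 E) (y1 + s * F1) (y2 + s * F2) (s\<^sup>2 * h) * F2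
      + eval3 (td3 E) (y1 + s * F1) (y2 + s * F2) (s\<^sup>2 * h) * (2 * s * h) = 0"
    (is "?D = 0") if "s \<noteq> 0" for s
  proof -
    have "((\<lambda>s. eval3 E (y1 + s * F1) (y2 + s * F2) (s\<^sup>2 * h)) has_field_derivative ?D) (at s)"
      by (rule eval3_chain) (auto intro!: derivative_eq_intros)
    moreover have "((\<lambda>s. eval3 E (y1 + s * F1) (y2 + s * F2) (s\<^sup>2 * h)) has_field_derivative 0) (at s)"
    proof (rule has_field_derivative_transform_within_open[where S = "- {0}" and f = "\<lambda>_. 0"])
      show "0 = eval3 E (y1 + z * F1) (y2 + z * F2) (z\<^sup>2 * h)" if "z \<in> - {0}" for z
        using zero[OF y hy, of z] that by (simp add: F)
    qed (use that in auto)
    ultimately show ?thesis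
      by (rule DERIV_unique)
  qed
  define w1 w2 where "w1 = eval2 (pd1 (pd1 f)) y1 y2 * (- F2) + eval2 (pd2 (pd1 f)) y1 y2 * F1"
    and "w2 = eval2 (pd1 (pd2 f)) y1 y2 * (- F2) + eval2 (pd2 (pd2 f)) y1 y2 * F1"
  have tangent: "eval3 (td1 E) (y1 + s * F1) (y2 + s * F2) (s\<^sup>2 * h) * (- F2 + s * w1)
      + eval3 (td2 E) (y1 + s * F1) (y2 + s * F2) (s\<^sup>2 * h) * (F1 + s * w2)
      + eval3 (td3 E) (y1 + s * F1) (y2 + s * F2) (s\<^sup>2 * h) * (s\<^sup>2 * (2 * F1 * w1 + 2 * F2 * w2)) = 0"
    if s: "s \<noteq> 0" for s
  proof -
    have "(\<lambda>y. eval3 E (fst y + s * eval2 (pd1 f) (fst y) (snd y))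
        (snd y + s * eval2 (pd2 f) (fst y) (snd y)) (s\<^sup>2 * eval2 (normsq f) (fst y) (snd y))) \<in> polyfun2"
      by (intro polyfun2_intros)
    then obtain Q where Q: "\<And>a b. eval3 E (a + s * eval2 (pd1 f) a b)
        (b + s * eval2 (pd2 f) a b) (s\<^sup>2 * eval2 (normsq f) a b) = eval2 Q a b"
      by (auto simp: polyfun2_def)
    \<comment> \<open>The factor \<open>normsq f\<close> covers curve points where the system has no
      solution; it is cancelled afterwards because \<open>f\<close> is prime and does not divide
      it.\<close>
    have "eval2 (Q * normsq f) a b = 0" if "eval2 f a b = 0" for a b
      using zero[OF that _ s] by (auto simp: Q [symmetric])
    then have "f dvd Q * normsq f"
      by (rule irreducible_nullstellensatz[OF irr deg])
    moreover have "prime_elem f"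
      using irr by (rule irreducible_imp_prime_elem)
    ultimately have "f dvd Q"
      using nd by (auto simp: prime_elem_dvd_mult_iff)
    then obtain \<alpha> where \<alpha>: "Q = f * \<alpha>" ..
    \<comment> \<open>The tangent line at (y1, y2). It may leave the curve, but \<open>f\<close> and
      its derivative along the line vanish at the point, hence so does the derivative of
      \<open>f * \<alpha>\<close>.\<close>
    define a b where "a = (\<lambda>r. y1 - r * F2)" and "b = (\<lambda>r. y2 + r * F1)"
    have ab0: "a 0 = y1" "b 0 = y2"
      by (simp_all add: a_def b_def)
    have da: "(a has_field_derivative - F2) (at 0)"
      unfolding a_def by (auto intro!: derivative_eq_intros)
    have db: "(b has_field_derivative F1) (at 0)"
      unfolding b_def by (auto intro!: derivative_eq_intros)
    note d2 = eval2_chain[OF da db, unfolded ab0]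
    have "((\<lambda>r. eval2 (f * \<alpha>) (a r) (b r)) has_field_derivative 0) (at 0)"
      unfolding eval2_hom
      by (rule derivative_eq_intros d2 refl)+ (simp add: ab0 y F)
    moreover have "((\<lambda>r. eval2 (f * \<alpha>) (a r) (b r)) has_field_derivative
       eval3 (td1 E) (y1 + s * F1) (y2 + s * F2) (s\<^sup>2 * h) * (- F2 + s * w1)
      + eval3 (td2 E) (y1 + s * F1) (y2 + s * F2) (s\<^sup>2 * h) * (F1 + s * w2)
      + eval3 (td3 E) (y1 + s * F1) (y2 + s * F2) (s\<^sup>2 * h) * (s\<^sup>2 * (2 * F1 * w1 + 2 * F2 * w2))) (at 0)"
    proof -
      have c1: "((\<lambda>r. a r + s * eval2 (pd1 f) (a r) (b r)) has_field_derivative - F2 + s * w1) (at 0)"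
        by (rule derivative_eq_intros d2 da refl)+ (simp add: w1_def)
      have c2: "((\<lambda>r. b r + s * eval2 (pd2 f) (a r) (b r)) has_field_derivative F1 + s * w2) (at 0)"
        by (rule derivative_eq_intros d2 db refl)+ (simp add: w2_def)
      have c3: "((\<lambda>r. s\<^sup>2 * eval2 (normsq f) (a r) (b r)) has_field_derivative
          s\<^sup>2 * (2 * F1 * w1 + 2 * F2 * w2)) (at 0)"
        unfolding eval2_normsq power2_eq_square
        by (rule derivative_eq_intros d2 refl)+
          (simp add: ab0 F [symmetric] w1_def w2_def algebra_simps)
      show ?thesis
        using eval3_chain[OF c1 c2 c3, of E] unfolding \<alpha> [symmetric] Q [symmetric]
        unfolding ab0 F [symmetric] .
    qed
    ultimately show ?thesis
      using DERIV_unique by blast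
  qed
  \<comment> \<open>The tangential component of the x-gradient of \<open>E\<close> along the normal
    line.\<close>
  define P where "P s = eval3 (td2 E) (y1 + s * F1) (y2 + s * F2) (s\<^sup>2 * h) * F1
      - eval3 (td1 E) (y1 + s * F1) (y2 + s * F2) (s\<^sup>2 * h) * F2" for s
  define \<kappa> where "\<kappa> = F1 * w2 - F2 * w1"
  have P: "P s * (h + s * \<kappa>) = 0" if "s \<noteq> 0" for s
    unfolding P_def \<kappa>_def by (rule gradient_identities[OF h normal[OF that] tangent[OF that]])
  have "P t = 0"
  proof (cases "h + t * \<kappa> = 0")
    case False
    with P[OF t] show ?thesis by simp
  next
    case True
    \<comment> \<open>a focal point: conclude by continuity along the normal line\<close>
    have "isCont P t"
      unfolding P_def
      by (intro continuous_intros DERIV_isCont[OF eval3_chain]) (auto intro!: derivative_eq_intros)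
    then have lim: "(P \<longlongrightarrow> P t) (at t)"
      by (simp add: isCont_def)
    have "P s = 0" if "s \<noteq> t" "s \<noteq> 0" for s
    proof -
      \<comment> \<open>As \<open>h\<close> is nonzero, so is \<open>\<kappa>\<close>; the Jacobian
        is linear in \<open>s\<close> and vanishes at \<open>t\<close> only.\<close>
      have "h + s * \<kappa> = (s - t) * \<kappa>"
        using True by algebra
      moreover have "\<kappa> \<noteq> 0"
        using True hy F(3) by auto
      ultimately show ?thesis
        using P[OF that(2)] that(1) by simp
    qed
    then have "eventually (\<lambda>s. P s = 0) (at t)"
      unfolding eventually_at_topological using t by (intro exI[of _ "- {0}"]) auto
    then have "(P \<longlongrightarrow> 0) (at t)"
      by (rule tendsto_eventually)
    with lim show ?thesis
      by (intro tendsto_unique[of "at t"]) auto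
  qed
  define e1 e2 e3 where "e1 = eval3 (td1 E) (y1 + t * F1) (y2 + t * F2) (t\<^sup>2 * h)"
    and "e2 = eval3 (td2 E) (y1 + t * F1) (y2 + t * F2) (t\<^sup>2 * h)"
    and "e3 = eval3 (td3 E) (y1 + t * F1) (y2 + t * F2) (t\<^sup>2 * h)"
  have P0: "e2 * F1 - e1 * F2 = 0"
    using \<open>P t = 0\<close> by (simp add: P_def e1_def e2_def)
  have N0: "e1 * F1 + e2 * F2 + e3 * (2 * t * h) = 0"
    using normal[OF t] by (simp add: e1_def e2_def e3_def)
  have h0: "h \<noteq> 0"
    using hy F(3) by simp
  \<comment> \<open>A gradient without tangential component is a multiple of (F1, F2), and the
    normal relation fixes the multiple as -2 t e3.\<close>
  have "h * (e1 + 2 * t * F1 * e3) = 0" "h * (e2 + 2 * t * F2 * e3) = 0"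
    using P0 N0 h by algebra+
  with h0 have "e1 + 2 * t * F1 * e3 = 0" "e2 + 2 * t * F2 * e3 = 0"
    by simp_all
  then have "e1 = - 2 * t * F1 * e3" "e2 = - 2 * t * F2 * e3"
    by algebra+
  then show "eval3 (td1 E) (y1 + t * F1) (y2 + t * F2) (t\<^sup>2 * h)
           = - 2 * t * F1 * eval3 (td3 E) (y1 + t * F1) (y2 + t * F2) (t\<^sup>2 * h)"
    and "eval3 (td2 E) (y1 + t * F1) (y2 + t * F2) (t\<^sup>2 * h)
           = - 2 * t * F2 * eval3 (td3 E) (y1 + t * F1) (y2 + t * F2) (t\<^sup>2 * h)"
    by (simp_all add: e1_def e2_def e3_def)
qed

text \<open>With (y, x, d) also (y, x, -d) solves the system, so the even and odd parts of
  \<open>g\<close> in d vanish separately. The identities for these parts combine by the chain rule;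
  the extra summand \<open>O'\<close> in the d-derivative is zero at the point.\<close>

lemma offset_normal:
  assumes irr: "irreducible f" and deg: "degree f > 0" and nd: "\<not> f dvd normsq f"
    and vanish: "\<forall>x d y u. offset_sys f d y x u \<longrightarrow> eval3 g (fst x) (snd x) d = 0"
    and sys: "offset_sys f d y x u" and d: "d \<noteq> 0"
  shows "d * eval3 (td1 g) (fst x) (snd x) d = - eval3 (td3 g) (fst x) (snd x) d * (fst x - fst y)"
    and "d * eval3 (td2 g) (fst x) (snd x) d = - eval3 (td3 g) (fst x) (snd x) d * (snd x - snd y)"
proof -
  obtain E O' where g: "\<And>a b c. eval3 g a b c = eval3 E a b (c\<^sup>2) + c * eval3 O' a b (c\<^sup>2)"
    using eval3_even_odd by blast
  have EO: "eval3 E (fst x) (snd x) (d\<^sup>2) = 0" "eval3 O' (fst x) (snd x) (d\<^sup>2) = 0"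
    if "offset_sys f d y x u" "d \<noteq> 0" for d y x u
  proof -
    have "offset_sys f (- d) y x u"
      using that(1) by (simp add: offset_sys_def bfun_def)
    then have "eval3 E (fst x) (snd x) (d\<^sup>2) - d * eval3 O' (fst x) (snd x) (d\<^sup>2) = 0"
      using vanish g by fastforce
    moreover have "eval3 E (fst x) (snd x) (d\<^sup>2) + d * eval3 O' (fst x) (snd x) (d\<^sup>2) = 0"
      using vanish that(1) g by metis
    ultimately have "2 * eval3 E (fst x) (snd x) (d\<^sup>2) = 0"
      "2 * d * eval3 O' (fst x) (snd x) (d\<^sup>2) = 0"
      by algebra+
    then show "eval3 E (fst x) (snd x) (d\<^sup>2) = 0" "eval3 O' (fst x) (snd x) (d\<^sup>2) = 0"
      using that(2) by simp_all
  qed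
  have E0: "\<forall>x d y u. offset_sys f d y x u \<longrightarrow> d \<noteq> 0 \<longrightarrow> eval3 E (fst x) (snd x) (d\<^sup>2) = 0"
    and O0: "\<forall>x d y u. offset_sys f d y x u \<longrightarrow> d \<noteq> 0 \<longrightarrow> eval3 O' (fst x) (snd x) (d\<^sup>2) = 0"
    using EO by blast+
  obtain t where t: "eval2 f (fst y) (snd y) = 0" "eval2 (normsq f) (fst y) (snd y) \<noteq> 0"
    "fst x = fst y + t * eval2 (pd1 f) (fst y) (snd y)"
    "snd x = snd y + t * eval2 (pd2 f) (fst y) (snd y)"
    "d\<^sup>2 = t\<^sup>2 * eval2 (normsq f) (fst y) (snd y)"
    using sys by (rule offset_sysE)
  have t0: "t \<noteq> 0"
    using t(5) d by auto
  note EE = offset_gradient_even[OF irr deg nd E0 t(1,2) t0 refl refl refl,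
      folded t(3) t(4) t(5)]
  note OO = offset_gradient_even[OF irr deg nd O0 t(1,2) t0 refl refl refl,
      folded t(3) t(4) t(5)]
  let ?x = "fst x" and ?y = "snd x"
  have g1: "eval3 (td1 g) ?x ?y d = eval3 (td1 E) ?x ?y (d\<^sup>2) + d * eval3 (td1 O') ?x ?y (d\<^sup>2)"
  proof -
    have "((\<lambda>s. eval3 g s ?y d) has_field_derivative eval3 (td1 g) ?x ?y d) (at ?x)"
      by (rule DERIV_cong[OF eval3_chain]) (auto intro!: derivative_eq_intros)
    moreover have "((\<lambda>s. eval3 g s ?y d) has_field_derivative
        eval3 (td1 E) ?x ?y (d\<^sup>2) + d * eval3 (td1 O') ?x ?y (d\<^sup>2)) (at ?x)"
      unfolding g by (rule derivative_eq_intros eval3_chain refl)+ simp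
    ultimately show ?thesis by (rule DERIV_unique)
  qed
  have g2: "eval3 (td2 g) ?x ?y d = eval3 (td2 E) ?x ?y (d\<^sup>2) + d * eval3 (td2 O') ?x ?y (d\<^sup>2)"
  proof -
    have "((\<lambda>s. eval3 g ?x s d) has_field_derivative eval3 (td2 g) ?x ?y d) (at ?y)"
      by (rule DERIV_cong[OF eval3_chain]) (auto intro!: derivative_eq_intros)
    moreover have "((\<lambda>s. eval3 g ?x s d) has_field_derivative
        eval3 (td2 E) ?x ?y (d\<^sup>2) + d * eval3 (td2 O') ?x ?y (d\<^sup>2)) (at ?y)"
      unfolding g by (rule derivative_eq_intros eval3_chain refl)+ simp
    ultimately show ?thesis by (rule DERIV_unique)
  qed
  have g3: "eval3 (td3 g) ?x ?y d = 2 * d * eval3 (td3 E) ?x ?y (d\<^sup>2)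
      + eval3 O' ?x ?y (d\<^sup>2) + 2 * d\<^sup>2 * eval3 (td3 O') ?x ?y (d\<^sup>2)"
  proof -
    have "((\<lambda>s. eval3 g ?x ?y s) has_field_derivative eval3 (td3 g) ?x ?y d) (at d)"
      by (rule DERIV_cong[OF eval3_chain]) (auto intro!: derivative_eq_intros)
    moreover have "((\<lambda>s. eval3 g ?x ?y s) has_field_derivative
       2 * d * eval3 (td3 E) ?x ?y (d\<^sup>2)
      + eval3 O' ?x ?y (d\<^sup>2) + 2 * d\<^sup>2 * eval3 (td3 O') ?x ?y (d\<^sup>2)) (at d)"
      unfolding g by (rule derivative_eq_intros eval3_chain refl)+
        (simp add: algebra_simps power2_eq_square)
    ultimately show ?thesis by (rule DERIV_unique)
  qed
  have xy: "fst x - fst y = t * eval2 (pd1 f) (fst y) (snd y)"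
    "snd x - snd y = t * eval2 (pd2 f) (fst y) (snd y)"
    using t(3,4) by simp_all
  show "d * eval3 (td1 g) ?x ?y d = - eval3 (td3 g) ?x ?y d * (fst x - fst y)"
    unfolding g1 g3 xy EE OO EO(2)[OF sys d] by algebra
  show "d * eval3 (td2 g) ?x ?y d = - eval3 (td3 g) ?x ?y d * (snd x - snd y)"
    unfolding g2 g3 xy EE OO EO(2)[OF sys d] by algebra
qed

section \<open>Generic fibres of the generic offset\<close>

text \<open>Polynomial identities on the image of the system pass to its Zariski closure, which is
  the surface g = 0.\<close>

lemma generic_offset_equation_vanishing:
  assumes g: "generic_offset_equation f g"
    and vanish: "\<And>x d y u. offset_sys f d y x u \<Longrightarrow> eval3 P (fst x) (snd x) d = 0"
    and "eval3 g a b c = 0"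
  shows "eval3 P a b c = 0"
proof -
  have "(a, b, c) \<in> generic_offset f"
    using g assms(3) unfolding generic_offset_equation_def by (auto simp: zero_set3_def)
  moreover have "{(fst x, snd x, d) | x d. \<exists>y u. offset_sys f d y x u} \<subseteq> zero_set3 {P}"
    using vanish by (auto simp: zero_set3_def)
  moreover have "zariski_closed3 (zero_set3 {P})"
    unfolding zariski_closed3_def by blast
  ultimately have "(a, b, c) \<in> zero_set3 {P}"
    unfolding generic_offset_def zariski_closure3_def by blast
  then show ?thesis
    by (simp add: zero_set3_def)
qed

text \<open>Multiplication by \<open>D\<close> turns an identity known only where \<open>D\<close>
  is nonzero into one on the whole image.\<close>

lemma generic_offset_vanishing_polyfun3:
  assumes g: "generic_offset_equation f g" and P: "P \<in> polyfun3"
    and vanish: "\<And>x d y u. offset_sys f d y x u \<Longrightarrow> eval2 D d (snd x) \<noteq> 0 \<Longrightarrow> P (fst x, snd x, d) = 0"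
    and "eval3 g a k d = 0" "eval2 D d k \<noteq> 0"
  shows "P (a, k, d) = 0"
proof -
  obtain Q where Q: "\<And>a b c. P (a, b, c) = eval3 Q a b c"
    using P by (auto simp: polyfun3_def)
  have "eval3 ([:D:] * Q) a k d = 0"
  proof (rule generic_offset_equation_vanishing[OF g _ assms(4)])
    fix x d y u
    assume sys: "offset_sys f d y x u"
    show "eval3 ([:D:] * Q) (fst x) (snd x) d = 0"
      using vanish[OF sys] by (auto simp: Q [symmetric])
  qed
  with assms(5) show ?thesis
    by (simp add: Q)
qed

lemma offset_equation_vanishes:
  assumes "generic_offset_equation f g" "offset_sys f d y x u"
  shows "eval3 g (fst x) (snd x) d = 0"
proof -
  have "(fst x, snd x, d) \<in> generic_offset f"
    unfolding generic_offset_def zariski_closure3_def using assms(2) by blast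
  also have "generic_offset f = zero_set3 {g}"
    using assms(1) by (simp add: generic_offset_equation_def)
  finally show ?thesis
    by (simp add: zero_set3_def)
qed

lemma offset_subset_generic_offset:
  assumes g: "generic_offset_equation f g" and "x \<in> offset f d"
  shows "eval3 g (fst x) (snd x) d = 0"
proof -
  have "(\<lambda>x. eval3 g (fst x) (snd x) d) \<in> polyfun2"
    by (intro polyfun2_intros)
  then obtain P where P: "\<And>a b. eval3 g a b d = eval2 P a b"
    by (auto simp: polyfun2_def)
  have "{x. \<exists>y u. offset_sys f d y x u} \<subseteq> zero_set2 {P}"
    using offset_equation_vanishes[OF g] by (force simp: zero_set2_def P)
  moreover have "zariski_closed2 (zero_set2 {P})"
    unfolding zariski_closed2_def by blast
  ultimately have "x \<in> zero_set2 {P}"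
    using assms(2) unfolding offset_def zariski_closure2_def by blast
  then show ?thesis
    by (auto simp: zero_set2_def P)
qed

text \<open>A common factor \<open>c\<close> of \<open>g = c c'\<close> and \<open>H\<close> vanishes at no generic point of the image of the
  offset system, so \<open>c'\<close> vanishes there and hence on the whole surface; comparing the number of
  roots on a generic line \<open>x\<^sub>2 = k\<close> gives \<open>deg c' = deg g\<close>.\<close>

lemma generic_nonvanishing:
  assumes g: "generic_offset_equation f g" and D: "D \<noteq> 0"
    and nonzero: "\<And>x d y u. offset_sys f d y x u \<Longrightarrow> eval2 D d (snd x) \<noteq> 0 \<Longrightarrow>
      eval3 H (fst x) (snd x) d \<noteq> 0"
  shows "\<exists>r. r \<noteq> 0 \<and> (\<forall>a k d. eval2 r d k \<noteq> 0 \<longrightarrow> eval3 g a k d = 0 \<longrightarrow> eval3 H a k d \<noteq> 0)"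
proof (cases "H = 0")
  \<comment> \<open>With H = 0 the image has no point where \<open>D\<close> is nonzero, so
    \<open>D\<close> vanishes at every zero of \<open>g\<close> and itself serves as
    \<open>r\<close>.\<close>
  case True
  have "eval2 D d k = 0" if "eval3 g a k d = 0" for a k d
  proof -
    have "eval3 [:D:] a k d = 0"
    proof (rule generic_offset_equation_vanishing[OF g _ that])
      fix x d y u
      assume sys: "offset_sys f d y x u"
      show "eval3 [:D:] (fst x) (snd x) d = 0"
        using nonzero[OF sys] True by auto
    qed
    then show ?thesis by simp
  qed
  with D show ?thesis by blast
next
  case False
  have sqf: "squarefree g"
    using g by (simp add: generic_offset_equation_def)
  then have g0: "g \<noteq> 0"
    by auto
  obtain r where r: "r \<noteq> 0"
    and card: "\<And>k d. eval2 r d k \<noteq> 0 \<Longrightarrow> card {a. eval3 g a k d = 0} = degree g"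
    using generic_separable[OF sqf] by blast
  show ?thesis
  proof (rule generic_coprime[OF False])
    fix c assume "c dvd g" "c dvd H"
    then obtain c' e where c': "g = c * c'" and e: "H = c * e"
      by (meson dvdE)
    have "c' \<noteq> 0"
      using g0 c' by auto
    \<comment> \<open>Choose a line that carries exactly deg g zeros of \<open>g\<close> and on
      which \<open>c'\<close> keeps its degree.\<close>
    with D r have "D * r * lead_coeff c' \<noteq> 0"
      by simp
    then obtain d k where dk: "eval2 (D * r * lead_coeff c') d k \<noteq> 0"
      using eval2_nonzero_witness by blast
    have vanish: "eval3 c' a k d = 0" if "eval3 g a k d = 0" for a
    proof -
      have "eval3 ([:D:] * c') a k d = 0"
      proof (rule generic_offset_equation_vanishing[OF g _ that])
        fix x d y u
        assume sys: "offset_sys f d y x u"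
        show "eval3 ([:D:] * c') (fst x) (snd x) d = 0"
          using nonzero[OF sys] offset_equation_vanishes[OF g sys] by (auto simp: c' e)
      qed
      with dk show ?thesis by simp
    qed
    have deg: "degree (specialize c' k d) = degree c'"
      using dk by (intro degree_specialize) simp
    have nz: "specialize c' k d \<noteq> 0"
      using dk by (metis coeff_0 coeff_specialize eval2_hom(3) mult_zero_right)
    have "degree g = card {a. eval3 g a k d = 0}"
      using card dk by simp
    also have "\<dots> \<le> card {a. poly (specialize c' k d) a = 0}"
      using vanish poly_roots_finite[OF nz] by (intro card_mono) auto
    also have "\<dots> \<le> degree c'"
      using card_poly_roots_bound[OF nz] deg by simp
    finally show "degree c = 0"
      using g0 by (simp add: c' degree_mult_eq)
  qed
qed

text \<open>The map from (x, d) back to \<open>y\<close> has denominator g_d. With it cleared, each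
  equation of the system is a polynomial identity that transfers from the image to the surface;
  \<open>r\<close> also keeps g_d and |grad f|^2 at the recovered point away from zero.\<close>

lemma generic_fibre:
  assumes std: "standing_assumptions f" and g: "generic_offset_equation f g"
  shows "\<exists>r. r \<noteq> 0 \<and> (\<forall>k d. eval2 r d k \<noteq> 0 \<longrightarrow> d \<noteq> 0 \<and>
      finite {a. eval3 g a k d = 0} \<and> card {a. eval3 g a k d = 0} = degree g \<and>
      (\<forall>a. eval3 g a k d = 0 \<longrightarrow> (\<exists>y u. offset_sys f d y (a, k) u)) \<and>
      (\<forall>a y u y' u'. offset_sys f d y (a, k) u \<longrightarrow> offset_sys f d y' (a, k) u' \<longrightarrow> y = y'))"
proof -
  have irr: "irreducible f" and nd: "\<not> f dvd normsq f"
    using std by (auto simp: standing_assumptions_def normsq_def)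
  note deg = standing_assumptions_degree_pos[OF std]
  have "\<forall>x d y u. offset_sys f d y x u \<longrightarrow> eval3 g (fst x) (snd x) d = 0"
    using offset_equation_vanishes[OF g] by blast
  note normal = offset_normal[OF irr deg nd this]
  have sqf: "squarefree g"
    using g by (simp add: generic_offset_equation_def)
  obtain r1 where r1: "r1 \<noteq> 0"
    and roots: "\<And>k d. eval2 r1 d k \<noteq> 0 \<Longrightarrow> finite {a. eval3 g a k d = 0}"
      "\<And>k d. eval2 r1 d k \<noteq> 0 \<Longrightarrow> card {a. eval3 g a k d = 0} = degree g"
    and sep: "\<And>k d a. eval2 r1 d k \<noteq> 0 \<Longrightarrow> eval3 g a k d = 0 \<Longrightarrow> eval3 (td1 g) a k d \<noteq> 0"
    using generic_separable[OF sqf] by blast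
  \<comment> \<open>The factor \<open>[:[:0, 1:]:]\<close> is the variable d; it excludes distance
    zero.\<close>
  define D where "D = r1 * [:[:0, 1:]:]"
  have D0: "D \<noteq> 0"
    using r1 by (simp add: D_def)
  have D: "eval2 D d k \<noteq> 0 \<longleftrightarrow> eval2 r1 d k \<noteq> 0 \<and> d \<noteq> 0" for d k
    by (auto simp: D_def)
  define G1 G2 G3 where "G1 = (\<lambda>z. eval3 (td1 g) (fst z) (fst (snd z)) (snd (snd z)))"
    and "G2 = (\<lambda>z. eval3 (td2 g) (fst z) (fst (snd z)) (snd (snd z)))"
    and "G3 = (\<lambda>z. eval3 (td3 g) (fst z) (fst (snd z)) (snd (snd z)))"
  \<comment> \<open>Numerators of y = x + d grad_x g / g_d, with common denominator
    \<open>G3\<close>.\<close>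
  define U V where "U = (\<lambda>z. fst z * G3 z + snd (snd z) * G1 z)"
    and "V = (\<lambda>z. fst (snd z) * G3 z + snd (snd z) * G2 z)"
  have G: "G1 \<in> polyfun3" "G2 \<in> polyfun3" "G3 \<in> polyfun3"
    unfolding G1_def G2_def G3_def by (intro polyfun3_intros)+
  have UV: "U \<in> polyfun3" "V \<in> polyfun3"
    unfolding U_def V_def by (intro polyfun3_intros G)+
  have recover: "G3 (fst x, snd x, d) \<noteq> 0"
    "fst y = U (fst x, snd x, d) / G3 (fst x, snd x, d)"
    "snd y = V (fst x, snd x, d) / G3 (fst x, snd x, d)"
    "d * G1 (fst x, snd x, d) = - G3 (fst x, snd x, d) * (fst x - fst y)"
    "d * G2 (fst x, snd x, d) = - G3 (fst x, snd x, d) * (snd x - snd y)"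
    if sys: "offset_sys f d y x u" and "eval2 D d (snd x) \<noteq> 0" for d y x u
  proof -
    have d: "d \<noteq> 0" and r: "eval2 r1 d (snd x) \<noteq> 0"
      using that(2) D by auto
    show N: "d * G1 (fst x, snd x, d) = - G3 (fst x, snd x, d) * (fst x - fst y)"
      "d * G2 (fst x, snd x, d) = - G3 (fst x, snd x, d) * (snd x - snd y)"
      using normal[OF sys d] by (simp_all add: G1_def G2_def G3_def)
    \<comment> \<open>Simplicity of the roots makes the x1-derivative nonzero, and the first
      identity in \<open>N\<close> then forces g_d to be nonzero.\<close>
    have "G1 (fst x, snd x, d) \<noteq> 0"
      using sep[OF r offset_equation_vanishes[OF g sys]] by (simp add: G1_def)
    then show G3: "G3 (fst x, snd x, d) \<noteq> 0"
      using N(1) d by auto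
    show "fst y = U (fst x, snd x, d) / G3 (fst x, snd x, d)"
      "snd y = V (fst x, snd x, d) / G3 (fst x, snd x, d)"
      using G3 N by (simp_all add: U_def V_def eq_divide_eq algebra_simps)
  qed
  note transfer = generic_offset_vanishing_polyfun3[OF g, where D = D]
  obtain N0 Pf where Pf: "Pf \<in> polyfun3" "\<And>z. G3 z \<noteq> 0 \<Longrightarrow> Pf z = G3 z ^ N0 * eval2 f (U z / G3 z) (V z / G3 z)"
    using eval2_quotient_polyfun3[OF UV G(3), of f] by blast
  obtain N1 P1 where P1: "P1 \<in> polyfun3" "\<And>z. G3 z \<noteq> 0 \<Longrightarrow> P1 z = G3 z ^ N1 * eval2 (pd1 f) (U z / G3 z) (V z / G3 z)"
    using eval2_quotient_polyfun3[OF UV G(3), of "pd1 f"] by blast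
  obtain N2 P2 where P2: "P2 \<in> polyfun3" "\<And>z. G3 z \<noteq> 0 \<Longrightarrow> P2 z = G3 z ^ N2 * eval2 (pd2 f) (U z / G3 z) (V z / G3 z)"
    using eval2_quotient_polyfun3[OF UV G(3), of "pd2 f"] by blast
  obtain Nh Ph where Ph: "Ph \<in> polyfun3" "\<And>z. G3 z \<noteq> 0 \<Longrightarrow> Ph z = G3 z ^ Nh * eval2 (normsq f) (U z / G3 z) (V z / G3 z)"
    using eval2_quotient_polyfun3[OF UV G(3), of "normsq f"] by blast
  \<comment> \<open>One polynomial gathers both conditions: the denominator and, up to powers of it,
    |grad f|^2 at the recovered point.\<close>
  have "(\<lambda>z. G3 z * Ph z) \<in> polyfun3"
    by (intro polyfun3_intros G Ph)
  then obtain H where H: "\<And>a b c. G3 (a, b, c) * Ph (a, b, c) = eval3 H a b c"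
    by (auto simp: polyfun3_def)
  have "\<exists>r. r \<noteq> 0 \<and> (\<forall>a k d. eval2 r d k \<noteq> 0 \<longrightarrow> eval3 g a k d = 0 \<longrightarrow> eval3 H a k d \<noteq> 0)"
  proof (rule generic_nonvanishing[OF g D0])
    fix x d y u
    assume sys: "offset_sys f d y x u" and Dd: "eval2 D d (snd x) \<noteq> 0"
    have "eval2 (normsq f) (fst y) (snd y) \<noteq> 0"
      using sys by (rule offset_sysE)
    then show "eval3 H (fst x) (snd x) d \<noteq> 0"
      unfolding H [symmetric] using recover(1-3)[OF sys Dd] Ph(2) by simp
  qed
  then obtain r2 where r2: "r2 \<noteq> 0"
    "\<And>a k d. eval2 r2 d k \<noteq> 0 \<Longrightarrow> eval3 g a k d = 0 \<Longrightarrow> eval3 H a k d \<noteq> 0"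
    by blast
  have exists: "\<exists>y u. offset_sys f d y (a, k) u"
    if Dd: "eval2 D d k \<noteq> 0" and "eval2 r2 d k \<noteq> 0" and root: "eval3 g a k d = 0" for a k d
  proof -
    define z where "z = (a, k, d)"
    have d: "d \<noteq> 0"
      using D Dd by blast
    have "eval3 H a k d \<noteq> 0"
      using r2(2) that by blast
    then have G3: "G3 z \<noteq> 0" and Ph0: "Ph z \<noteq> 0"
      unfolding H [symmetric] z_def by auto
    have f0: "Pf z = 0"
      unfolding z_def
    proof (rule transfer[OF Pf(1) _ root Dd])
      fix x d y u
      assume sys: "offset_sys f d y x u" and Dd: "eval2 D d (snd x) \<noteq> 0"
      have "eval2 f (fst y) (snd y) = 0"
        using sys by (rule offset_sysE)
      then show "Pf (fst x, snd x, d) = 0"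
        using recover(1-3)[OF sys Dd] Pf(2) by simp
    qed
    \<comment> \<open>The equation b = 0 with x - y replaced by -d grad_x g / g_d.\<close>
    have eikonal: "(G1 z)\<^sup>2 + (G2 z)\<^sup>2 - (G3 z)\<^sup>2 = 0"
      unfolding z_def
    proof (rule transfer[OF _ _ root Dd])
      show "(\<lambda>z. (G1 z)\<^sup>2 + (G2 z)\<^sup>2 - (G3 z)\<^sup>2) \<in> polyfun3"
        by (intro polyfun3_diff polyfun3_power polyfun3_intros G)
    next
      fix x d y u
      assume sys: "offset_sys f d y x u" and Dd: "eval2 D d (snd x) \<noteq> 0"
      have "(fst x - fst y)\<^sup>2 + (snd x - snd y)\<^sup>2 = d\<^sup>2"
        using sys by (simp add: offset_sys_def bfun_def)
      then have "d\<^sup>2 * ((G1 (fst x, snd x, d))\<^sup>2 + (G2 (fst x, snd x, d))\<^sup>2 - (G3 (fst x, snd x, d))\<^sup>2) = 0"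
        using recover(4,5)[OF sys Dd] by algebra
      moreover have "d \<noteq> 0"
        using D Dd by blast
      ultimately show "(G1 (fst x, snd x, d))\<^sup>2 + (G2 (fst x, snd x, d))\<^sup>2 - (G3 (fst x, snd x, d))\<^sup>2 = 0"
        by simp
    qed
    \<comment> \<open>The equation n = 0 with denominators cleared; the powers of \<open>G3\<close>
      even out the exponents in \<open>P1\<close> and \<open>P2\<close>.\<close>
    have parallel: "G3 z ^ N1 * P2 z * G1 z - G3 z ^ N2 * P1 z * G2 z = 0"
      unfolding z_def
    proof (rule transfer[OF _ _ root Dd])
      show "(\<lambda>z. G3 z ^ N1 * P2 z * G1 z - G3 z ^ N2 * P1 z * G2 z) \<in> polyfun3"
        by (intro polyfun3_diff polyfun3_power polyfun3_intros G P1 P2)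
    next
      fix x d y u
      assume sys: "offset_sys f d y x u" and Dd: "eval2 D d (snd x) \<noteq> 0"
      define z where "z = (fst x, snd x, d)"
      note rec = recover[OF sys Dd, folded z_def]
      have "d \<noteq> 0"
        using D Dd by blast
      have P12: "P1 z = G3 z ^ N1 * eval2 (pd1 f) (fst y) (snd y)"
        "P2 z = G3 z ^ N2 * eval2 (pd2 f) (fst y) (snd y)"
        using P1(2) P2(2) rec by simp_all
      have "eval2 (pd2 f) (fst y) (snd y) * (fst x - fst y) = eval2 (pd1 f) (fst y) (snd y) * (snd x - snd y)"
        using sys by (simp add: offset_sys_def nfun_def)
      then have "d * (eval2 (pd2 f) (fst y) (snd y) * G1 z - eval2 (pd1 f) (fst y) (snd y) * G2 z) = 0"
        using rec(4,5) by algebra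
      with \<open>d \<noteq> 0\<close> have "eval2 (pd2 f) (fst y) (snd y) * G1 z - eval2 (pd1 f) (fst y) (snd y) * G2 z = 0"
        by simp
      moreover have "G3 z ^ N1 * P2 z * G1 z - G3 z ^ N2 * P1 z * G2 z = G3 z ^ N1 * G3 z ^ N2 *
          (eval2 (pd2 f) (fst y) (snd y) * G1 z - eval2 (pd1 f) (fst y) (snd y) * G2 z)"
        unfolding P12 by (simp add: algebra_simps)
      ultimately have "G3 z ^ N1 * P2 z * G1 z - G3 z ^ N2 * P1 z * G2 z = 0"
        by simp
      then show "G3 (fst x, snd x, d) ^ N1 * P2 (fst x, snd x, d) * G1 (fst x, snd x, d)
          - G3 (fst x, snd x, d) ^ N2 * P1 (fst x, snd x, d) * G2 (fst x, snd x, d) = 0"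
        by (simp add: z_def)
    qed
    define y1 y2 where "y1 = U z / G3 z" and "y2 = V z / G3 z"
    have diff: "G3 z * (a - y1) = - d * G1 z" "G3 z * (k - y2) = - d * G2 z"
    proof -
      have "y1 * G3 z = U z" "y2 * G3 z = V z"
        using G3 by (simp_all add: y1_def y2_def)
      moreover have "U z = a * G3 z + d * G1 z" "V z = k * G3 z + d * G2 z"
        by (simp_all add: U_def V_def z_def)
      ultimately show "G3 z * (a - y1) = - d * G1 z" "G3 z * (k - y2) = - d * G2 z"
        by algebra+
    qed
    have "eval2 f y1 y2 = 0"
      using f0 Pf(2)[OF G3] G3 by (simp add: y1_def y2_def)
    moreover have "(a - y1)\<^sup>2 + (k - y2)\<^sup>2 - d\<^sup>2 = 0"
    proof -
      have "(G3 z)\<^sup>2 * ((a - y1)\<^sup>2 + (k - y2)\<^sup>2 - d\<^sup>2) = 0"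
        using diff eikonal by algebra
      with G3 show ?thesis by simp
    qed
    moreover have "- eval2 (pd2 f) y1 y2 * (a - y1) + eval2 (pd1 f) y1 y2 * (k - y2) = 0"
    proof -
      have "G3 z ^ N1 * P2 z * G1 z - G3 z ^ N2 * P1 z * G2 z = G3 z ^ N1 * G3 z ^ N2 *
          (eval2 (pd2 f) y1 y2 * G1 z - eval2 (pd1 f) y1 y2 * G2 z)"
        unfolding P1(2)[OF G3] P2(2)[OF G3] y1_def y2_def by (simp add: algebra_simps)
      then have "G3 z ^ N1 * G3 z ^ N2 * (eval2 (pd2 f) y1 y2 * G1 z - eval2 (pd1 f) y1 y2 * G2 z) = 0"
        using parallel by simp
      then have "eval2 (pd2 f) y1 y2 * G1 z - eval2 (pd1 f) y1 y2 * G2 z = 0"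
        using G3 by simp
      then have "G3 z * (- eval2 (pd2 f) y1 y2 * (a - y1) + eval2 (pd1 f) y1 y2 * (k - y2)) = 0"
        using diff by algebra
      with G3 show ?thesis by simp
    qed
    moreover have "eval2 (normsq f) y1 y2 \<noteq> 0"
      using Ph0 Ph(2)[OF G3] by (auto simp: y1_def y2_def)
    ultimately have "offset_sys f d (y1, y2) (a, k) (1 / eval2 (normsq f) y1 y2)"
      by (simp add: offset_sys_def bfun_def nfun_def wfun_def eval2_normsq)
    then show ?thesis by blast
  qed
  \<comment> \<open>Both curve points are given by the same rational function of (a, k, d).\<close>
  have unique: "y = y'"
    if "eval2 D d k \<noteq> 0" "offset_sys f d y (a, k) u" "offset_sys f d y' (a, k) u'" for a k d y y' u u'
    using recover(2,3)[OF that(2)] recover(2,3)[OF that(3)] that(1) by (simp add: prod_eq_iff)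
  have "d \<noteq> 0 \<and>
      finite {a. eval3 g a k d = 0} \<and> card {a. eval3 g a k d = 0} = degree g \<and>
      (\<forall>a. eval3 g a k d = 0 \<longrightarrow> (\<exists>y u. offset_sys f d y (a, k) u)) \<and>
      (\<forall>a y u y' u'. offset_sys f d y (a, k) u \<longrightarrow> offset_sys f d y' (a, k) u' \<longrightarrow> y = y')"
    if "eval2 (D * r2) d k \<noteq> 0" for k d
  proof -
    have Dd: "eval2 D d k \<noteq> 0" and rd: "eval2 r2 d k \<noteq> 0"
      using that by auto
    then have "d \<noteq> 0" "eval2 r1 d k \<noteq> 0"
      using D by blast+
    then show ?thesis
      using roots exists[OF Dd rd] unique[OF Dd] by blast
  qed
  moreover have "D * r2 \<noteq> 0"
    using D0 r2(1) by simp
  ultimately show ?thesis by blast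
qed

section \<open>Solutions over a generic horizontal line\<close>

theorem mainTheorem4:
  fixes f :: bipoly and g :: tripoly
  assumes "standing_assumptions f"
    and "generic_offset_equation f g"
  shows "\<exists>\<Delta>. zariski_open2 \<Delta> \<and> \<Delta> \<noteq> {} \<and>
    (\<forall>d0 k0. (d0, k0) \<in> \<Delta> \<longrightarrow>
      (\<exists>\<Gamma> :: ((complex \<times> complex) \<times> (complex \<times> complex) \<times> complex) set.
         finite \<Gamma> \<and> card \<Gamma> = degree g \<and>
         (\<forall>(p, q, u) \<in> \<Gamma>. sys2 f d0 k0 p q u) \<and>
         inj_on (\<lambda>(p, q, u). q) \<Gamma> \<and>
         (\<lambda>(p, q, u). q) ` \<Gamma> = {x. snd x = k0} \<inter> offset f d0 \<and>
         inj_on (\<lambda>(p, q, u). p) \<Gamma> \<and>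
         (\<forall>(p, q, u) \<in> \<Gamma>. regular_point f p \<and> \<not> ramification_point f p) \<and>
         (\<forall>p \<in> curve f. snd p = k0 \<longrightarrow> \<not> ramification_point f p) \<and>
         (\<forall>(p, q, u) \<in> \<Gamma>. p \<in> curve f \<inter> S_set f d0 k0) \<and>
         (\<forall>p \<in> curve f \<inter> S_set f d0 k0. \<not> ramification_point f p \<longrightarrow>
            (\<exists>q u. (p, q, u) \<in> \<Gamma>))))"
proof -
  have irr: "irreducible f"
    using assms(1) by (simp add: standing_assumptions_def)
  note ram_finite = finite_ramification_points[OF irr standing_assumptions_degree_pos[OF assms(1)]]
  obtain r where r: "r \<noteq> 0"
    and fibre: "\<And>k d. eval2 r d k \<noteq> 0 \<Longrightarrow> d \<noteq> 0 \<and>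
      finite {a. eval3 g a k d = 0} \<and> card {a. eval3 g a k d = 0} = degree g \<and>
      (\<forall>a. eval3 g a k d = 0 \<longrightarrow> (\<exists>y u. offset_sys f d y (a, k) u)) \<and>
      (\<forall>a y u y' u'. offset_sys f d y (a, k) u \<longrightarrow> offset_sys f d y' (a, k) u' \<longrightarrow> y = y')"
    using generic_fibre[OF assms] by blast
  \<comment> \<open>One factor k - y2 for each of the finitely many ramification points, so that the
    line y2 = k avoids them all.\<close>
  define D where "D = r * (\<Prod>p | ramification_point f p. [:[:- snd p:], 1:])"
  have D0: "D \<noteq> 0"
    using r ram_finite by (simp add: D_def)
  have D: "eval2 r d k \<noteq> 0" "ramification_point f p \<Longrightarrow> snd p \<noteq> k" if "eval2 D d k \<noteq> 0" for d k p
  proof -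
    have nz: "eval2 r d k * (\<Prod>p | ramification_point f p. k - snd p) \<noteq> 0"
      using that by (simp add: D_def)
    then show "eval2 r d k \<noteq> 0"
      by simp
    show "snd p \<noteq> k" if "ramification_point f p"
    proof -
      have "\<forall>p\<in>{p. ramification_point f p}. k - snd p \<noteq> 0"
        using nz unfolding mult_eq_0_iff prod_zero_iff[OF ram_finite] by blast
      with that have "k - snd p \<noteq> 0"
        by blast
      then show ?thesis by simp
    qed
  qed
  define \<Delta> where "\<Delta> = {(d, k). eval2 D d k \<noteq> 0}"
  have "- \<Delta> = zero_set2 {D}"
    by (auto simp: \<Delta>_def zero_set2_def)
  then have "zariski_open2 \<Delta>"
    unfolding zariski_open2_def zariski_closed2_def by blast
  moreover have "\<Delta> \<noteq> {}"
    using eval2_nonzero_witness[OF D0] by (auto simp: \<Delta>_def)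
  moreover have "\<exists>\<Gamma> :: ((complex \<times> complex) \<times> (complex \<times> complex) \<times> complex) set.
         finite \<Gamma> \<and> card \<Gamma> = degree g \<and>
         (\<forall>(p, q, u) \<in> \<Gamma>. sys2 f d0 k0 p q u) \<and>
         inj_on (\<lambda>(p, q, u). q) \<Gamma> \<and>
         (\<lambda>(p, q, u). q) ` \<Gamma> = {x. snd x = k0} \<inter> offset f d0 \<and>
         inj_on (\<lambda>(p, q, u). p) \<Gamma> \<and>
         (\<forall>(p, q, u) \<in> \<Gamma>. regular_point f p \<and> \<not> ramification_point f p) \<and>
         (\<forall>p \<in> curve f. snd p = k0 \<longrightarrow> \<not> ramification_point f p) \<and>
         (\<forall>(p, q, u) \<in> \<Gamma>. p \<in> curve f \<inter> S_set f d0 k0) \<and>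
         (\<forall>p \<in> curve f \<inter> S_set f d0 k0. \<not> ramification_point f p \<longrightarrow>
            (\<exists>q u. (p, q, u) \<in> \<Gamma>))" if "(d0, k0) \<in> \<Delta>" for d0 k0
  proof -
    have Dd: "eval2 D d0 k0 \<noteq> 0"
      using that by (simp add: \<Delta>_def)
    note fib = fibre[OF D(1)[OF Dd]]
    have noram: "\<not> ramification_point f p" if "snd p = k0" for p
      using D(2)[OF Dd] that by blast
    \<comment> \<open>All solutions are taken: \<open>generic_fibre\<close> supplies the count, and
      (b) then only asks for some solution over p.\<close>
    define \<Gamma> where "\<Gamma> = {(p, q, u). sys2 f d0 k0 p q u}"
    have \<Gamma>: "(p, q, u) \<in> \<Gamma> \<longleftrightarrow> offset_sys f d0 p q u \<and> snd q = k0" for p q u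
      by (simp add: \<Gamma>_def sys2_def)
    \<comment> \<open>If f2(p) = 0, then x2 = y2 + t f2 gives y2 = k0, and p would be a ramification
      point on the line.\<close>
    have f2: "eval2 (pd2 f) (fst p) (snd p) \<noteq> 0" if "(p, q, u) \<in> \<Gamma>" for p q u
    proof
      assume 0: "eval2 (pd2 f) (fst p) (snd p) = 0"
      have sys: "offset_sys f d0 p q u" "snd q = k0"
        using that \<Gamma> by auto
      obtain t where "eval2 f (fst p) (snd p) = 0" "snd q = snd p + t * eval2 (pd2 f) (fst p) (snd p)"
        using sys(1) by (rule offset_sysE)
      then show False
        using noram[of p] 0 sys(2) by (auto simp: ramification_point_def on_curve_def)
    qed
    have p_eq: "p = p'" if "(p, q, u) \<in> \<Gamma>" "(p', q, u') \<in> \<Gamma>" for p p' q u u'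
    proof -
      have "q = (fst q, k0)"
        using that(1) by (simp add: \<Gamma> prod_eq_iff)
      then have "offset_sys f d0 p (fst q, k0) u" "offset_sys f d0 p' (fst q, k0) u'"
        using that by (simp_all add: \<Gamma>)
      then show ?thesis
        using fib by blast
    qed
    have u_eq: "u = u'" if "(p, q, u) \<in> \<Gamma>" "(p, q', u') \<in> \<Gamma>" for p q q' u u'
    proof -
      have sys: "offset_sys f d0 p q u" "offset_sys f d0 p q' u'"
        using that by (auto simp: \<Gamma>)
      have "u = 1 / eval2 (normsq f) (fst p) (snd p)"
        using sys(1) by (rule offset_sysE)
      moreover have "u' = 1 / eval2 (normsq f) (fst p) (snd p)"
        using sys(2) by (rule offset_sysE)
      ultimately show ?thesis by simp
    qed
    have q_eq: "q = q'" if "(p, q, u) \<in> \<Gamma>" "(p, q', u') \<in> \<Gamma>" for p q q' u u'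
    proof -
      have sys: "offset_sys f d0 p q u" "snd q = k0" "offset_sys f d0 p q' u'" "snd q' = k0"
        using that by (auto simp: \<Gamma>)
      obtain t where t: "fst q = fst p + t * eval2 (pd1 f) (fst p) (snd p)"
        "snd q = snd p + t * eval2 (pd2 f) (fst p) (snd p)"
        using sys(1) by (rule offset_sysE)
      obtain t' where t': "fst q' = fst p + t' * eval2 (pd1 f) (fst p) (snd p)"
        "snd q' = snd p + t' * eval2 (pd2 f) (fst p) (snd p)"
        using sys(3) by (rule offset_sysE)
      \<comment> \<open>The height k0 = y2 + t f2(p) determines t, as f2(p) is nonzero.\<close>
      have "t = t'"
        using t(2) t'(2) sys(2,4) f2[OF that(1)] by auto
      with t(1) t'(1) sys(2,4) show ?thesis
        by (simp add: prod_eq_iff)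
    qed
    have inj_q: "inj_on (\<lambda>(p, q, u). q) \<Gamma>"
    proof (rule inj_onI)
      fix x y
      assume xy: "x \<in> \<Gamma>" "y \<in> \<Gamma>" "(\<lambda>(p, q, u). q) x = (\<lambda>(p, q, u). q) y"
      obtain p q u p' u' where x: "x = (p, q, u)" and y: "y = (p', q, u')"
        using xy(3) by (cases x, cases y) auto
      have "p = p'"
        using xy(1,2) unfolding x y by (rule p_eq)
      moreover have "u = u'"
        using xy(1,2) unfolding x y \<open>p = p'\<close> by (rule u_eq)
      ultimately show "x = y"
        by (simp add: x y)
    qed
    have inj_p: "inj_on (\<lambda>(p, q, u). p) \<Gamma>"
    proof (rule inj_onI)
      fix x y
      assume xy: "x \<in> \<Gamma>" "y \<in> \<Gamma>" "(\<lambda>(p, q, u). p) x = (\<lambda>(p, q, u). p) y"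
      obtain p q u q' u' where x: "x = (p, q, u)" and y: "y = (p, q', u')"
        using xy(3) by (cases x, cases y) auto
      have "q = q'"
        using xy(1,2) unfolding x y by (rule q_eq)
      moreover have "u = u'"
        using xy(1,2) unfolding x y by (rule u_eq)
      ultimately show "x = y"
        by (simp add: x y)
    qed
    have image: "(\<lambda>(p, q, u). q) ` \<Gamma> = {x. snd x = k0 \<and> eval3 g (fst x) (snd x) d0 = 0}"
    proof (intro equalityI subsetI)
      fix x assume "x \<in> (\<lambda>(p, q, u). q) ` \<Gamma>"
      then obtain p u where "(p, x, u) \<in> \<Gamma>"
        by auto
      then show "x \<in> {x. snd x = k0 \<and> eval3 g (fst x) (snd x) d0 = 0}"
        using offset_equation_vanishes[OF assms(2)] unfolding \<Gamma> by blast
    next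
      fix x assume "x \<in> {x. snd x = k0 \<and> eval3 g (fst x) (snd x) d0 = 0}"
      then have x: "snd x = k0" "eval3 g (fst x) k0 d0 = 0"
        by auto
      then obtain y u where "offset_sys f d0 y (fst x, k0) u"
        using fib by blast
      moreover have "(fst x, k0) = x"
        using x(1) by (simp add: prod_eq_iff)
      ultimately have "(y, x, u) \<in> \<Gamma>"
        using x(1) by (simp add: \<Gamma>)
      from imageI[OF this, of "\<lambda>(p, q, u). q"] show "x \<in> (\<lambda>(p, q, u). q) ` \<Gamma>"
        by simp
    qed
    \<comment> \<open>The image lies in the offset, and the offset in g = 0. On this line all zeros
      of \<open>g\<close> belong to the image, so the closure adds no point.\<close>
    have image_offset: "(\<lambda>(p, q, u). q) ` \<Gamma> = {x. snd x = k0} \<inter> offset f d0"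
    proof (rule equalityI)
      show "(\<lambda>(p, q, u). q) ` \<Gamma> \<subseteq> {x. snd x = k0} \<inter> offset f d0"
      proof
        fix x assume "x \<in> (\<lambda>(p, q, u). q) ` \<Gamma>"
        then obtain p u where "(p, x, u) \<in> \<Gamma>"
          by auto
        then show "x \<in> {x. snd x = k0} \<inter> offset f d0"
          unfolding offset_def zariski_closure2_def \<Gamma> by blast
      qed
      show "{x. snd x = k0} \<inter> offset f d0 \<subseteq> (\<lambda>(p, q, u). q) ` \<Gamma>"
        unfolding image using offset_subset_generic_offset[OF assms(2)] by blast
    qed
    have "(\<lambda>(p, q, u). q) ` \<Gamma> = (\<lambda>a. (a, k0)) ` {a. eval3 g a k0 d0 = 0}"
      unfolding image by (auto simp: image_iff)
    then have "finite ((\<lambda>(p, q, u). q) ` \<Gamma>)" "card ((\<lambda>(p, q, u). q) ` \<Gamma>) = degree g"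
      using fib card_image[of "\<lambda>a. (a, k0)" "{a. eval3 g a k0 d0 = 0}"]
      by (auto simp: inj_on_def)
    then have card: "finite \<Gamma>" "card \<Gamma> = degree g"
      using inj_q by (simp_all add: finite_image_iff card_image)
    have S: "p \<in> curve f \<inter> S_set f d0 k0" if "(p, q, u) \<in> \<Gamma>" for p q u
    proof -
      have sys: "offset_sys f d0 p q u" and "snd q = k0"
        using that by (auto simp: \<Gamma>)
      obtain t where t: "eval2 f (fst p) (snd p) = 0"
        "snd q = snd p + t * eval2 (pd2 f) (fst p) (snd p)"
        "d0\<^sup>2 = t\<^sup>2 * eval2 (normsq f) (fst p) (snd p)"
        using sys by (rule offset_sysE)
      \<comment> \<open>The height condition reads y2 - k0 = -t f2; together with d0^2 = t^2 |grad
        f|^2 it gives s = 0.\<close>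
      have "(snd p - k0)\<^sup>2 = t\<^sup>2 * (eval2 (pd2 f) (fst p) (snd p))\<^sup>2"
        using t(2) \<open>snd q = k0\<close> by algebra
      then have "sfun f p d0 k0 = 0"
        unfolding sfun_def eval2_normsq [symmetric] t(3) by simp
      with t(1) show ?thesis
        by (simp add: curve_def on_curve_def S_set_def)
    qed
    have ex: "\<exists>q u. (p, q, u) \<in> \<Gamma>"
      if "p \<in> curve f \<inter> S_set f d0 k0" "\<not> ramification_point f p" for p
    proof -
      define F1 F2 h where "F1 = eval2 (pd1 f) (fst p) (snd p)" and "F2 = eval2 (pd2 f) (fst p) (snd p)"
        and "h = eval2 (normsq f) (fst p) (snd p)"
      have p: "eval2 f (fst p) (snd p) = 0" and F20: "F2 \<noteq> 0"
        using that by (auto simp: curve_def on_curve_def ramification_point_def F2_def)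
      have s: "h * (snd p - k0)\<^sup>2 = F2\<^sup>2 * d0\<^sup>2"
        using that(1) by (simp add: S_set_def sfun_def h_def F2_def eval2_normsq)
      have "d0 \<noteq> 0"
        using fib by blast
      then have "h \<noteq> 0"
        using s F20 by auto
      \<comment> \<open>The parameter at which the normal line of p meets x2 = k0; s = 0 then says
        that the squared distance from p is d0^2.\<close>
      define t where "t = (k0 - snd p) / F2"
      have "snd p + t * F2 = k0"
        using F20 by (simp add: t_def)
      moreover have "d0\<^sup>2 = t\<^sup>2 * h"
      proof -
        have "snd p - k0 = - t * F2"
          using F20 by (simp add: t_def)
        then have "F2\<^sup>2 * (d0\<^sup>2 - t\<^sup>2 * h) = 0"
          using s by algebra
        with F20 show ?thesis by simp
      qed
      ultimately have "(p, (fst p + t * F1, k0), 1 / h) \<in> \<Gamma>"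
        using offset_sys_normal_point[OF p, of d0 t] \<open>h \<noteq> 0\<close>
        unfolding \<Gamma> F1_def F2_def h_def by simp
      then show ?thesis by blast
    qed
    have reg: "regular_point f p \<and> \<not> ramification_point f p" if "(p, q, u) \<in> \<Gamma>" for p q u
      using f2[OF that] S[OF that] by (auto simp: regular_point_def ramification_point_def curve_def)
    show ?thesis
    proof (intro exI[of _ \<Gamma>] conjI)
      show "\<forall>(p, q, u)\<in>\<Gamma>. sys2 f d0 k0 p q u"
        by (auto simp: \<Gamma>_def)
      show "\<forall>p\<in>curve f. snd p = k0 \<longrightarrow> \<not> ramification_point f p"
        using noram by blast
      show "\<forall>(p, q, u)\<in>\<Gamma>. p \<in> curve f \<inter> S_set f d0 k0"
        using S by blast
      show "\<forall>(p, q, u)\<in>\<Gamma>. regular_point f p \<and> \<not> ramification_point f p"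
        using reg by blast
      show "\<forall>p\<in>curve f \<inter> S_set f d0 k0. \<not> ramification_point f p \<longrightarrow> (\<exists>q u. (p, q, u) \<in> \<Gamma>)"
        using ex by blast
    qed (fact card inj_q inj_p image_offset)+
  qed
  ultimately show ?thesis by blast
qed

end
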